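(* Suppose $\mathscr T=(V,E)$ is an extremal directed tree and $n$ is a positive integer. Then there exists a subnormal weighted shift $S_{\boldsymbol\lambda}$ on $\mathscr T$ with nonzero weights $\boldsymbol\lambda=\{\lambda_v\}_{v\in V^\circ}\subseteq \mathbb C\setminus\{0\}$ such that $S_{\boldsymbol\lambda}^n$ is densely defined and $\mathcal D(S_{\boldsymbol\lambda}^{n+1})=\{0\}$.
   Context: A directed tree $\mathscr T=(V,E)$ is a directed graph with nonempty vertex set $V$ and edge set $E\subseteq V\times V$ without loops $(v,v)$, which is connected (as an undirected graph), has no directed circuits, and in which each vertex $u$ has at most one parent, i.e. at most one $v\in V$ with $(v,u)\in E$; when it exists, the parent is denoted $\mathrm{par}(u)$. A vertex without a parent is called a root; if it exists, it is unique and denoted $\mathrm{root}$. Put $V^\circ=V\setminus\{\mathrm{root}\}$ if $\mathscr T$ has a root and $V^\circ=V$ otherwise. For $u\in V$, $\mathrm{Chi}(u)=\{v\in V:(u,v)\in E\}$. The tree $\mathscr T$ is extremal if $\mathrm{Chi}(u)$ is countably infinite for every $u\in V$ (an extremal directed tree may have a root or be rootless). $\ell^2(V)$ is the Hilbert space of square summable complex functions on $V$. For $\boldsymbol\lambda=\{\lambda_v\}_{v\in V^\circ}\subseteq\mathbb C$, the weighted shift $S_{\boldsymbol\lambda}$ on $\mathscr T$ with weights $\boldsymbol\lambda$ is the operator in $\ell^2(V)$ with domain $\mathcal D(S_{\boldsymbol\lambda})=\{f\in\ell^2(V):\Lambda_{\mathscr T}f\in\ell^2(V)\}$ and $S_{\boldsymbol\lambda}f=\Lambda_{\mathscr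 T}f$ for $f \in \mathcal D(S_{\boldsymbol\lambda})$, where for $f:V\to\mathbb C$, $(\Lambda_{\mathscr T}f)(v)=\lambda_v f(\mathrm{par}(v))$ if $v\in V^\circ$ and $(\Lambda_{\mathscr T}f)(\mathrm{root})=0$ (if the root exists). Operators in Hilbert spaces are linear and possibly unbounded; $\mathcal D(A)$ is the domain of $A$, and powers $A^n$ have their natural (maximal) domains: $\mathcal D(A^{k+1})=\{h\in\mathcal D(A^k):A^kh\in\mathcal D(A)\}$. A closed densely defined operator $N$ is normal if $NN^*=N^*N$. A densely defined operator $A$ in a complex Hilbert space $\mathcal H$ is subnormal if there exist a complex Hilbert space $\mathcal K\supseteq\mathcal H$ (isometric embedding) and a normal operator $N$ in $\mathcal K$ such that $\mathcal D(A)\subseteq\mathcal D(N)$ and $Ah=Nh$ for all $h\in\mathcal D(A)$. *)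

theory Defs
  imports "HOL-Analysis.Analysis" "HOL-Algebra.Module"
begin

section \<open>Complex Hilbert spaces with explicit carrier\<close>

definition complex_ring :: "complex ring" where
  "complex_ring = \<lparr>carrier = UNIV, mult = (*), one = 1, zero = 0, add = (+)\<rparr>"

text \<open>The fields \<^term>\<open>mult\<close> and \<^term>\<open>one\<close>, inherited from
  the module record, play no role. The inner product is linear in its first argument.\<close>

record 'a inner_space = "(complex, 'a) module" +
  ip :: "'a \<Rightarrow> 'a \<Rightarrow> complex"

definition hnorm :: "'a inner_space \<Rightarrow> 'a \<Rightarrow> real" where
  "hnorm H x = sqrt (Re (ip H x x))"

text \<open>The value 0 off the carrier makes this an instance of
  \<^locale>\<open>Metric_space\<close>, which asks for nonnegativity and symmetry everywhere.\<close>

definition hdist :: "'a inner_space \<Rightarrow> 'a \<Rightarrow> 'a \<Rightarrow> real" where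
  "hdist H x y =
    (if x \<in> carrier H \<and> y \<in> carrier H then hnorm H (x \<ominus>\<^bsub>H\<^esub> y) else 0)"

abbreviation htopology :: "'a inner_space \<Rightarrow> 'a topology" where
  "htopology H \<equiv> Metric_space.mtopology (carrier H) (hdist H)"

locale complex_hilbert_space = Module.module complex_ring H
  for H :: "'a inner_space" (structure) +
  assumes ip_add_left:
      "\<lbrakk>x \<in> carrier H; y \<in> carrier H; z \<in> carrier H\<rbrakk>
        \<Longrightarrow> ip H (x \<oplus>\<^bsub>H\<^esub> y) z = ip H x z + ip H y z"
    and ip_smult_left:
      "\<lbrakk>x \<in> carrier H; y \<in> carrier H\<rbrakk> \<Longrightarrow> ip H (c \<odot>\<^bsub>H\<^esub> x) y = c * ip H x y"
    and ip_commute: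
      "\<lbrakk>x \<in> carrier H; y \<in> carrier H\<rbrakk> \<Longrightarrow> ip H y x = cnj (ip H x y)"
    and ip_nonneg: "x \<in> carrier H \<Longrightarrow> 0 \<le> Re (ip H x x)"
    and ip_definite: "\<lbrakk>x \<in> carrier H; ip H x x = 0\<rbrakk> \<Longrightarrow> x = \<zero>\<^bsub>H\<^esub>"
    and complete: "Metric_space.mcomplete (carrier H) (hdist H)"

definition isometric_embedding ::
    "'a inner_space \<Rightarrow> 'b inner_space \<Rightarrow> ('a \<Rightarrow> 'b) \<Rightarrow> bool" where
  "isometric_embedding H K J \<longleftrightarrow>
    J \<in> carrier H \<rightarrow> carrier K \<and>
    (\<forall>x\<in>carrier H. \<forall>y\<in>carrier H. J (x \<oplus>\<^bsub>H\<^esub> y) = J x \<oplus>\<^bsub>K\<^esub> J y) \<and>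
    (\<forall>c. \<forall>x\<in>carrier H. J (c \<odot>\<^bsub>H\<^esub> x) = c \<odot>\<^bsub>K\<^esub> J x) \<and>
    (\<forall>x\<in>carrier H. \<forall>y\<in>carrier H. ip K (J x) (J y) = ip H x y)"


section \<open>Unbounded operators\<close>

text \<open>An operator in \<open>H\<close> is a partial map; its domain is \<^term>\<open>dom A\<close>,
  the product \<open>A B\<close> with its maximal domain is \<^term>\<open>A \<circ>\<^sub>m B\<close>, and
  equality of operators includes equality of domains.\<close>

definition linear_operator :: "'a inner_space \<Rightarrow> ('a \<rightharpoonup> 'a) \<Rightarrow> bool" where
  "linear_operator H A \<longleftrightarrow>
    submodule (dom A) complex_ring H \<and> ran A \<subseteq> carrier H \<and>
    (\<forall>x\<in>dom A. \<forall>y\<in>dom A. the (A (x \<oplus>\<^bsub>H\<^esub> y)) = the (A x) \<oplus>\<^bsub>H\<^esub> the (A y)) \<and>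
    (\<forall>c. \<forall>x\<in>dom A. the (A (c \<odot>\<^bsub>H\<^esub> x)) = c \<odot>\<^bsub>H\<^esub> the (A x))"

definition densely_defined :: "'a inner_space \<Rightarrow> ('a \<rightharpoonup> 'a) \<Rightarrow> bool" where
  "densely_defined H A \<longleftrightarrow> htopology H closure_of dom A = carrier H"

definition closed_operator :: "'a inner_space \<Rightarrow> ('a \<rightharpoonup> 'a) \<Rightarrow> bool" where
  "closed_operator H A \<longleftrightarrow>
    closedin (prod_topology (htopology H) (htopology H)) (Map.graph A)"

primrec op_power :: "'a inner_space \<Rightarrow> ('a \<rightharpoonup> 'a) \<Rightarrow> nat \<Rightarrow> ('a \<rightharpoonup> 'a)" where
  "op_power H A 0 = (\<lambda>h. if h \<in> carrier H then Some h else None)"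
| "op_power H A (Suc k) = A \<circ>\<^sub>m op_power H A k"

text \<open>For densely defined \<open>A\<close> the vector \<open>z\<close> below is unique.\<close>

definition adjoint_op :: "'a inner_space \<Rightarrow> ('a \<rightharpoonup> 'a) \<Rightarrow> ('a \<rightharpoonup> 'a)" where
  "adjoint_op H A = (\<lambda>y.
    if y \<in> carrier H \<and> (\<exists>z\<in>carrier H. \<forall>x\<in>dom A. ip H (the (A x)) y = ip H x z)
    then Some (THE z. z \<in> carrier H \<and> (\<forall>x\<in>dom A. ip H (the (A x)) y = ip H x z))
    else None)"

definition normal_operator :: "'a inner_space \<Rightarrow> ('a \<rightharpoonup> 'a) \<Rightarrow> bool" where
  "normal_operator H N \<longleftrightarrow>
    linear_operator H N \<and> closed_operator H N \<and> densely_defined H N \<and>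
    N \<circ>\<^sub>m adjoint_op H N = adjoint_op H N \<circ>\<^sub>m N"

text \<open>A quantifier over Hilbert spaces has to range over the carriers in some fixed type. For a
  space \<open>H\<close> with elements of type \<open>'a\<close>, the type \<open>'a \<Rightarrow> complex\<close> is large
  enough that nothing is lost: if \<open>A\<close> has a normal extension \<open>N\<close> in any Hilbert space
  at all, then \<open>N\<close> may be cut down to the smallest closed subspace that reduces \<open>N\<close>
  and contains \<open>H\<close>. This subspace is the closed span of the images of \<open>H\<close> under all
  words in the bounded transform of \<open>N\<close> and its adjoint, hence has at most
  \<open>max(|H|, aleph_0) ^ aleph_0\<close> elements, and this does not exceed the cardinality of
  \<open>'a \<Rightarrow> complex\<close>, so that it can be copied onto a set of elements of this type.\<close>

definition subnormal_operator :: "'a inner_space \<Rightarrow> ('a \<rightharpoonup> 'a) \<Rightarrow> bool" where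
  "subnormal_operator H A \<longleftrightarrow>
    complex_hilbert_space H \<and> linear_operator H A \<and> densely_defined H A \<and>
    (\<exists>(K :: ('a \<Rightarrow> complex) inner_space) J N.
      complex_hilbert_space K \<and> isometric_embedding H K J \<and> normal_operator K N \<and>
      J ` dom A \<subseteq> dom N \<and>
      (\<forall>h\<in>dom A. J (the (A h)) = the (N (J h))))"


section \<open>The space of square summable functions\<close>

text \<open>Functions on \<open>V\<close> are represented by functions that vanish outside \<open>V\<close>.\<close>

definition ell2_set :: "'v set \<Rightarrow> ('v \<Rightarrow> complex) set" where
  "ell2_set V = {f. (\<forall>v. v \<notin> V \<longrightarrow> f v = 0) \<and> (\<lambda>v. (cmod (f v))\<^sup>2) summable_on V}"

definition ell2 :: "'v set \<Rightarrow> ('v \<Rightarrow> complex) inner_space" where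
  "ell2 V = \<lparr>carrier = ell2_set V, mult = undefined, one = undefined,
    zero = (\<lambda>v. 0), add = (\<lambda>f g v. f v + g v), smult = (\<lambda>c f v. c * f v),
    ip = (\<lambda>f g. \<Sum>\<^sub>\<infinity>v\<in>V. f v * cnj (g v))\<rparr>"


section \<open>Directed trees and weighted shifts\<close>

locale directed_tree =
  fixes V :: "'v set" and E :: "('v \<times> 'v) set"
  assumes nonempty: "V \<noteq> {}"
    and edges: "E \<subseteq> V \<times> V"
    and no_loops: "(v, v) \<notin> E"
    and connected: "\<lbrakk>u \<in> V; v \<in> V\<rbrakk> \<Longrightarrow> (u, v) \<in> (E \<union> E\<inverse>)\<^sup>*"
    and no_circuits: "acyclic E"
    and parent_unique: "\<lbrakk>(v, u) \<in> E; (w, u) \<in> E\<rbrakk> \<Longrightarrow> v = w"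

definition children :: "('v \<times> 'v) set \<Rightarrow> 'v \<Rightarrow> 'v set" where
  "children E u = {v. (u, v) \<in> E}"

definition parent :: "('v \<times> 'v) set \<Rightarrow> 'v \<Rightarrow> 'v" where
  "parent E u = (THE v. (v, u) \<in> E)"

definition roots :: "'v set \<Rightarrow> ('v \<times> 'v) set \<Rightarrow> 'v set" where
  "roots V E = {u \<in> V. \<nexists>v. (v, u) \<in> E}"

definition nonroots :: "'v set \<Rightarrow> ('v \<times> 'v) set \<Rightarrow> 'v set" where
  "nonroots V E = V - roots V E"

definition extremal :: "'v set \<Rightarrow> ('v \<times> 'v) set \<Rightarrow> bool" where
  "extremal V E \<longleftrightarrow> (\<forall>u\<in>V. countable (children E u) \<and> infinite (children E u))"

definition shift_map ::
    "'v set \<Rightarrow> ('v \<times> 'v) set \<Rightarrow> ('v \<Rightarrow> complex) \<Rightarrow> ('v \<Rightarrow> complex) \<Rightarrow> 'v \<Rightarrow> complex"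
  where
  "shift_map V E l f = (\<lambda>v. if v \<in> nonroots V E then l v * f (parent E v) else 0)"

definition weighted_shift ::
    "'v set \<Rightarrow> ('v \<times> 'v) set \<Rightarrow> ('v \<Rightarrow> complex) \<Rightarrow> (('v \<Rightarrow> complex) \<rightharpoonup> ('v \<Rightarrow> complex))"
  where
  "weighted_shift V E l = (\<lambda>f.
    if f \<in> ell2_set V \<and> shift_map V E l f \<in> ell2_set V
    then Some (shift_map V E l f) else None)"

end

theory Submission
  imports Defs
begin

text \<open>Every quantity attached to a vertex is an integral against a measure on the points
  \<open>1, 2, 3, \<dots>\<close>. Give each vertex \<open>v\<close> a positive mass function \<open>m v\<close> on these points such that
  the functions of the children \<open>v\<^sub>j\<close> of \<open>u\<close>, scaled by \<open>2 ^ (- j - 1)\<close>, add up to \<open>t\<close> times the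
  function of \<open>u\<close>, where \<open>t\<close> is the coordinate. With the weights that these scalars induce, the
  squared norm of the \<open>i\<close>-th power of the shift at the unit vector of \<open>u\<close> is the \<open>i\<close>-th moment of
  the normalised mass function of \<open>u\<close> (lemma \<open>nsum_L_power\<close>). Images of different unit
  vectors under one power have disjoint supports, so if the moments are finite up to order \<open>n\<close> and
  infinite at order \<open>n + 1\<close>, for every vertex, then finitely supported functions lie in the domain of
  the \<open>n\<close>-th power and only \<open>0\<close> lies in the domain of the next one.

  The required splitting of \<open>t m(t)\<close> into infinitely many functions with one moment more than
  it has itself is possible because the child \<open>v\<^sub>j\<close> can take the function of its parent, changed at the
  single point with index \<open>j\<close>: the mass missing at a point is supplied by the one child that owns
  this point. Thus neighbouring mass functions differ by a factor that is \<open>1\<close> except at one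
  point, and such factors integrate to a potential along any directed tree, with or without
  a root (lemma \<open>ex_potential\<close>). All mass functions are comparable to the one at a base
  vertex, for which the moments can be prescribed.

  For subnormality, spread the unit vector of \<open>u\<close> over the points \<open>t\<close> with coefficients the square
  roots of the normalised masses. This embeds the space isometrically into
  the square summable functions on pairs \<open>(u, t)\<close> and turns the shift into the square root of \<open>t\<close>
  times a weighted shift that is isometric for each fixed \<open>t\<close> (lemma \<open>spread_intertwines\<close>). An
  isometry has a unitary dilation on two copies of its space (locale \<open>dilated_shift\<close>). It
  commutes with the multiplication by the square root of \<open>t\<close>, and the product of a unitary
  and a commuting real multiplication operator is normal (locale \<open>commuting_unitary\<close>).\<close>

section \<open>Square summable functions form a Hilbert space\<close>

text \<open>Elements of the space over \<open>X\<close> vanish outside \<open>X\<close>, so sums over the whole type give its norm and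
  inner product. These do not mention \<open>X\<close>, which lets functions with different supports be
  compared.\<close>

definition l2norm :: "('v \<Rightarrow> complex) \<Rightarrow> real" where
  "l2norm f = sqrt (\<Sum>\<^sub>\<infinity>v. (cmod (f v))\<^sup>2)"

definition scal :: "('v \<Rightarrow> complex) \<Rightarrow> ('v \<Rightarrow> complex) \<Rightarrow> complex" where
  "scal f g = (\<Sum>\<^sub>\<infinity>v. f v * cnj (g v))"

lemma ell2_set_alt:
  "f \<in> ell2_set X \<longleftrightarrow> (\<forall>v. v \<notin> X \<longrightarrow> f v = 0) \<and> (\<lambda>v. (cmod (f v))\<^sup>2) summable_on UNIV"
proof -
  have "(\<lambda>v. (cmod (f v))\<^sup>2) summable_on UNIV \<longleftrightarrow> (\<lambda>v. (cmod (f v))\<^sup>2) summable_on X"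
    if "\<forall>v. v \<notin> X \<longrightarrow> f v = 0"
    by (rule summable_on_cong_neutral) (use that in auto)
  then show ?thesis by (auto simp: ell2_set_def)
qed

lemma ell2_summable: "f \<in> ell2_set X \<Longrightarrow> (\<lambda>v. (cmod (f v))\<^sup>2) summable_on UNIV"
  by (simp add: ell2_set_alt)

lemma ell2_off: "f \<in> ell2_set X \<Longrightarrow> v \<notin> X \<Longrightarrow> f v = 0"
  by (simp add: ell2_set_def)

lemma ell2_ip_eq: "f \<in> ell2_set X \<Longrightarrow> ip (ell2 X) f g = scal f g"
  unfolding ell2_def scal_def by (simp, rule infsum_cong_neutral) (auto simp: ell2_set_def)

lemma L2_set_le_l2norm:
  assumes "f \<in> ell2_set X" "finite F"
  shows "L2_set (\<lambda>v. cmod (f v)) F \<le> l2norm f"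
  unfolding L2_set_def l2norm_def
  by (intro real_sqrt_le_mono finite_sum_le_infsum ell2_summable[OF assms(1)] assms) auto

text \<open>Finite sections determine membership and norm; in this form the triangle and
  Cauchy--Schwarz inequalities for finite sums carry over.\<close>

lemma ell2_boundedI:
  assumes "\<And>v. v \<notin> X \<Longrightarrow> f v = 0" "\<And>F. finite F \<Longrightarrow> L2_set (\<lambda>v. cmod (f v)) F \<le> B"
  shows "f \<in> ell2_set X" "l2norm f \<le> B"
proof -
  have B: "0 \<le> B" using assms(2)[of "{}"] by simp
  have *: "(\<Sum>v\<in>F. (cmod (f v))\<^sup>2) \<le> B\<^sup>2" if "finite F" for F
  proof -
    have "sqrt (\<Sum>v\<in>F. (cmod (f v))\<^sup>2) \<le> B" using assms(2)[OF that] by (simp add: L2_set_def)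
    then show ?thesis using B real_sqrt_le_iff[of _ "B\<^sup>2"] by simp
  qed
  have s: "(\<lambda>v. (cmod (f v))\<^sup>2) summable_on UNIV"
    by (rule nonneg_bdd_above_summable_on) (use * in \<open>auto simp: bdd_above_def\<close>)
  then show "f \<in> ell2_set X" using assms(1) by (auto simp: ell2_set_alt)
  have "(\<Sum>\<^sub>\<infinity>v. (cmod (f v))\<^sup>2) \<le> B\<^sup>2"
    by (rule infsum_le_finite_sums[OF s]) (use * in auto)
  then show "l2norm f \<le> B" unfolding l2norm_def
    using B real_sqrt_le_iff[of _ "B\<^sup>2"] by simp
qed

lemma l2norm_nonneg [simp]: "0 \<le> l2norm f"
  by (simp add: l2norm_def infsum_nonneg)

lemma cmod_le_l2norm:
  assumes "f \<in> ell2_set X" shows "cmod (f v) \<le> l2norm f"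
  using L2_set_le_l2norm[OF assms, of "{v}"] by simp

lemma ell2_add:
  assumes "f \<in> ell2_set X" "g \<in> ell2_set X"
  shows "(\<lambda>v. f v + g v) \<in> ell2_set X" "l2norm (\<lambda>v. f v + g v) \<le> l2norm f + l2norm g"
proof -
  have "L2_set (\<lambda>v. cmod (f v + g v)) F \<le> l2norm f + l2norm g" if "finite F" for F
  proof -
    have "L2_set (\<lambda>v. cmod (f v + g v)) F \<le> L2_set (\<lambda>v. cmod (f v) + cmod (g v)) F"
      by (rule L2_set_mono) (auto simp: norm_triangle_ineq)
    also have "\<dots> \<le> L2_set (\<lambda>v. cmod (f v)) F + L2_set (\<lambda>v. cmod (g v)) F"
      by (rule L2_set_triangle_ineq)
    also have "\<dots> \<le> l2norm f + l2norm g"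
      using assms that by (intro add_mono L2_set_le_l2norm)
    finally show ?thesis .
  qed
  moreover have "f v + g v = 0" if "v \<notin> X" for v using assms that by (simp add: ell2_off)
  ultimately show "(\<lambda>v. f v + g v) \<in> ell2_set X" "l2norm (\<lambda>v. f v + g v) \<le> l2norm f + l2norm g"
    using ell2_boundedI[of X "\<lambda>v. f v + g v" "l2norm f + l2norm g"] by blast+
qed

lemma ell2_smult: "f \<in> ell2_set X \<Longrightarrow> (\<lambda>v. c * f v) \<in> ell2_set X"
  by (auto simp: ell2_set_def norm_mult power_mult_distrib intro: summable_on_cmult_right)

lemma ell2_zero: "(\<lambda>v. 0) \<in> ell2_set X"
  by (simp add: ell2_set_def)

lemma ell2_uminus: "f \<in> ell2_set X \<Longrightarrow> (\<lambda>v. - f v) \<in> ell2_set X"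
  using ell2_smult[of f X "-1"] by simp

lemma ell2_diff: "f \<in> ell2_set X \<Longrightarrow> g \<in> ell2_set X \<Longrightarrow> (\<lambda>v. f v - g v) \<in> ell2_set X"
  using ell2_add(1)[of f X "\<lambda>v. - g v"] ell2_uminus[of g X] by simp

lemma ell2_finite_support:
  assumes "finite {v. f v \<noteq> 0}" "\<And>v. v \<notin> X \<Longrightarrow> f v = 0"
  shows "f \<in> ell2_set X"
  using assms by (auto simp: ell2_set_alt intro!: finite_nonzero_values_imp_summable_on)

lemma ell2_product:
  assumes "f \<in> ell2_set X" "g \<in> ell2_set Y"
  shows "(\<lambda>v. f v * cnj (g v)) summable_on UNIV" "cmod (scal f g) \<le> l2norm f * l2norm g"
proof -
  have *: "(\<Sum>v\<in>F. cmod (f v * cnj (g v))) \<le> l2norm f * l2norm g" if "finite F" for F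
  proof -
    have "(\<Sum>v\<in>F. cmod (f v * cnj (g v))) = (\<Sum>v\<in>F. \<bar>cmod (f v)\<bar> * \<bar>cmod (g v)\<bar>)"
      by (simp add: norm_mult)
    also have "\<dots> \<le> L2_set (\<lambda>v. cmod (f v)) F * L2_set (\<lambda>v. cmod (g v)) F"
      by (rule L2_set_mult_ineq)
    also have "\<dots> \<le> l2norm f * l2norm g"
      using assms that by (intro mult_mono L2_set_le_l2norm) auto
    finally show ?thesis .
  qed
  then have abs: "(\<lambda>v. cmod (f v * cnj (g v))) summable_on UNIV"
    by (intro nonneg_bdd_above_summable_on) (auto simp: bdd_above_def)
  then show "(\<lambda>v. f v * cnj (g v)) summable_on UNIV" by (rule abs_summable_summable)
  have "cmod (scal f g) \<le> (\<Sum>\<^sub>\<infinity>v. cmod (f v * cnj (g v)))"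
    unfolding scal_def by (rule norm_infsum_bound[OF abs])
  also have "\<dots> \<le> l2norm f * l2norm g"
    by (rule infsum_le_finite_sums[OF abs]) (use * in auto)
  finally show "cmod (scal f g) \<le> l2norm f * l2norm g" .
qed

lemma scal_add_left:
  assumes "f \<in> ell2_set X" "g \<in> ell2_set X" "h \<in> ell2_set X"
  shows "scal (\<lambda>v. f v + g v) h = scal f h + scal g h"
  using assms ell2_product(1) unfolding scal_def
  by (subst infsum_add[symmetric]) (auto simp: distrib_right)

lemma scal_smult_left: "scal (\<lambda>v. c * f v) g = c * scal f g"
  unfolding scal_def by (simp add: mult.assoc infsum_cmult_right')

lemma scal_commute: "scal g f = cnj (scal f g)"
  unfolding scal_def by (simp flip: infsum_cnj add: mult.commute)

lemma scal_self:
  assumes "f \<in> ell2_set X" shows "scal f f = complex_of_real ((l2norm f)\<^sup>2)"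
proof -
  have "((\<lambda>v. (cmod (f v))\<^sup>2) has_sum (\<Sum>\<^sub>\<infinity>v. (cmod (f v))\<^sup>2)) UNIV"
    by (rule has_sum_infsum[OF ell2_summable[OF assms]])
  then have "((\<lambda>v. complex_of_real ((cmod (f v))\<^sup>2)) has_sum of_real (\<Sum>\<^sub>\<infinity>v. (cmod (f v))\<^sup>2)) UNIV"
    by (rule has_sum_of_real)
  then have "((\<lambda>v. f v * cnj (f v)) has_sum of_real (\<Sum>\<^sub>\<infinity>v. (cmod (f v))\<^sup>2)) UNIV"
    by (simp only: complex_norm_square)
  then show ?thesis unfolding scal_def l2norm_def
    by (simp add: infsumI infsum_nonneg)
qed

lemma cring_complex_ring: "cring complex_ring"
proof (rule cringI)
  show "abelian_group complex_ring"
  proof (rule abelian_groupI)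
    fix x assume "x \<in> carrier complex_ring"
    show "\<exists>y\<in>carrier complex_ring. y \<oplus>\<^bsub>complex_ring\<^esub> x = \<zero>\<^bsub>complex_ring\<^esub>"
      by (rule bexI[of _ "-x"]) (auto simp: complex_ring_def)
  qed (auto simp: complex_ring_def)
  show "comm_monoid complex_ring"
    by (rule comm_monoidI) (auto simp: complex_ring_def)
qed (auto simp: complex_ring_def distrib_right)

lemma abelian_group_ell2: "abelian_group (ell2 X)"
proof (rule abelian_groupI)
  fix f assume "f \<in> carrier (ell2 X)"
  then show "\<exists>g\<in>carrier (ell2 X). g \<oplus>\<^bsub>ell2 X\<^esub> f = \<zero>\<^bsub>ell2 X\<^esub>"
    by (intro bexI[of _ "\<lambda>v. - f v"]) (auto simp: ell2_def ell2_uminus)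
qed (auto simp: ell2_def ell2_add ell2_zero add_ac)

lemma module_ell2: "Module.module complex_ring (ell2 X)"
  by (rule moduleI[OF cring_complex_ring abelian_group_ell2])
    (auto simp: ell2_def complex_ring_def ell2_smult algebra_simps)

lemma ell2_minus:
  assumes "f \<in> ell2_set X" "g \<in> ell2_set X"
  shows "f \<ominus>\<^bsub>ell2 X\<^esub> g = (\<lambda>v. f v - g v)"
proof -
  have "\<ominus>\<^bsub>ell2 X\<^esub> g = (\<lambda>v. - g v)"
    by (rule abelian_group.minus_equality[OF abelian_group_ell2])
      (use assms in \<open>auto simp: ell2_def ell2_uminus\<close>)
  then show ?thesis by (simp add: a_minus_def) (simp add: ell2_def)
qed

lemma carrier_ell2 [simp]: "carrier (ell2 X) = ell2_set X"
  by (simp add: ell2_def)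

lemma hdist_ell2:
  assumes "f \<in> ell2_set X" "g \<in> ell2_set X"
  shows "hdist (ell2 X) f g = l2norm (\<lambda>v. f v - g v)"
  using assms ell2_diff[OF assms]
  by (simp add: hdist_def hnorm_def ell2_minus ell2_ip_eq scal_self[OF ell2_diff[OF assms]])

lemma l2norm_minus_commute: "l2norm (\<lambda>v. f v - g v) = l2norm (\<lambda>v. g v - f v)"
  by (simp add: l2norm_def norm_minus_commute)

lemma Metric_space_ell2: "Metric_space (ell2_set X) (hdist (ell2 X))"
proof
  fix f g h
  show "0 \<le> hdist (ell2 X) f g"
    using hdist_ell2[of f X g] by (cases "f \<in> ell2_set X \<and> g \<in> ell2_set X") (auto simp: hdist_def)
  show "hdist (ell2 X) f g = hdist (ell2 X) g f"
    using hdist_ell2[of f X g] hdist_ell2[of g X f] l2norm_minus_commute[of f g]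
    by (cases "f \<in> ell2_set X \<and> g \<in> ell2_set X") (auto simp: hdist_def)
  assume f: "f \<in> ell2_set X" and g: "g \<in> ell2_set X"
  show "hdist (ell2 X) f g = 0 \<longleftrightarrow> f = g"
  proof
    assume "hdist (ell2 X) f g = 0"
    then have "cmod (f v - g v) \<le> 0" for v
      using cmod_le_l2norm[OF ell2_diff[OF f g], of v] by (simp add: hdist_ell2[OF f g])
    then show "f = g" by auto
  qed (use f in \<open>simp add: hdist_ell2 l2norm_def\<close>)
  assume h: "h \<in> ell2_set X"
  show "hdist (ell2 X) f h \<le> hdist (ell2 X) f g + hdist (ell2 X) g h"
    using ell2_add(2)[OF ell2_diff[OF f g] ell2_diff[OF g h]] f g h by (simp add: hdist_ell2)
qed

text \<open>A Cauchy sequence converges pointwise, and the bounds on finite partial sums pass to the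
  pointwise limit.\<close>

lemma mcomplete_ell2: "Metric_space.mcomplete (ell2_set X) (hdist (ell2 X))"
proof -
  interpret Metric_space "ell2_set X" "hdist (ell2 X)" by (rule Metric_space_ell2)
  show ?thesis unfolding mcomplete_def
  proof (intro allI impI)
    fix s assume "MCauchy s"
    then have s: "s n \<in> ell2_set X" for n by (auto simp: MCauchy_def)
    have C: "\<exists>N. \<forall>m\<ge>N. \<forall>n\<ge>N. l2norm (\<lambda>v. s m v - s n v) < e" if "e > 0" for e
      using \<open>MCauchy s\<close> that unfolding MCauchy_def by (simp add: hdist_ell2 s)
    have "Cauchy (\<lambda>n. s n v)" for v
    proof (rule CauchyI)
      fix e :: real assume "e > 0"
      then obtain N where N: "\<forall>m\<ge>N. \<forall>n\<ge>N. l2norm (\<lambda>v. s m v - s n v) < e" using C by blast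
      then show "\<exists>N. \<forall>m\<ge>N. \<forall>n\<ge>N. norm (s m v - s n v) < e"
        using cmod_le_l2norm[OF ell2_diff[OF s s], where v = v] by (meson le_less_trans)
    qed
    then have "\<exists>l. (\<lambda>n. s n v) \<longlonglongrightarrow> l" for v by (metis Cauchy_convergent convergent_def)
    then obtain l where l: "\<And>v. (\<lambda>n. s n v) \<longlonglongrightarrow> l v" by metis
    have l0: "l v = 0" if "v \<notin> X" for v
      using l[of v] ell2_off[OF s that] by (simp add: LIMSEQ_const_iff)
    have tail: "(\<lambda>v. l v - s n v) \<in> ell2_set X \<and> l2norm (\<lambda>v. l v - s n v) \<le> e"
      if N: "\<forall>m\<ge>N. \<forall>n\<ge>N. l2norm (\<lambda>v. s m v - s n v) < e" and "n \<ge> N" for N n e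
    proof -
      have "L2_set (\<lambda>v. cmod (l v - s n v)) F \<le> e" if "finite F" for F
      proof (rule LIMSEQ_le_const2)
        show "(\<lambda>m. L2_set (\<lambda>v. cmod (s m v - s n v)) F) \<longlonglongrightarrow> L2_set (\<lambda>v. cmod (l v - s n v)) F"
          unfolding L2_set_def by (intro tendsto_intros l)
        show "\<exists>N. \<forall>m\<ge>N. L2_set (\<lambda>v. cmod (s m v - s n v)) F \<le> e"
        proof (intro exI allI impI)
          fix m assume "m \<ge> N"
          have "L2_set (\<lambda>v. cmod (s m v - s n v)) F \<le> l2norm (\<lambda>v. s m v - s n v)"
            by (rule L2_set_le_l2norm[OF ell2_diff[OF s s] that])
          then show "L2_set (\<lambda>v. cmod (s m v - s n v)) F \<le> e"
            using N \<open>m \<ge> N\<close> \<open>n \<ge> N\<close> by (meson le_less_trans less_imp_le)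
        qed
      qed
      moreover have "l v - s n v = 0" if "v \<notin> X" for v
        using l0[OF that] ell2_off[OF s that] by simp
      ultimately show ?thesis using ell2_boundedI[of X "\<lambda>v. l v - s n v" e] by blast
    qed
    obtain N where "\<forall>m\<ge>N. \<forall>n\<ge>N. l2norm (\<lambda>v. s m v - s n v) < 1" using C[of 1] by auto
    then have "(\<lambda>v. l v - s N v) \<in> ell2_set X" using tail by blast
    from ell2_add(1)[OF this s[of N]] have lX: "l \<in> ell2_set X" by simp
    have "limitin mtopology s l sequentially"
      unfolding limit_metric_sequentially
    proof (intro conjI allI impI lX)
      fix e :: real assume "e > 0"
      then obtain N where "\<forall>m\<ge>N. \<forall>n\<ge>N. l2norm (\<lambda>v. s m v - s n v) < e/2" using C[of "e/2"] by auto
      then have "l2norm (\<lambda>v. l v - s n v) \<le> e/2" if "n \<ge> N" for n using tail that by blast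
      then have "\<forall>n\<ge>N. s n \<in> ell2_set X \<and> hdist (ell2 X) (s n) l < e"
        using \<open>e > 0\<close> s lX by (force simp: hdist_ell2 l2norm_minus_commute[of _ l])
      then show "\<exists>N. \<forall>n\<ge>N. s n \<in> ell2_set X \<and> hdist (ell2 X) (s n) l < e" by blast
    qed
    then show "\<exists>l. limitin mtopology s l sequentially" by blast
  qed
qed

lemma complex_hilbert_space_ell2: "complex_hilbert_space (ell2 X)"
proof (intro complex_hilbert_space.intro complex_hilbert_space_axioms.intro module_ell2)
  fix f g h c
  note [simp] = ell2_ip_eq ell2_add ell2_smult
  assume f: "f \<in> carrier (ell2 X)"
  then have f': "f \<in> ell2_set X" by simp
  show "0 \<le> Re (ip (ell2 X) f f)" using f' by (simp add: scal_self)
  show "f = \<zero>\<^bsub>ell2 X\<^esub>" if "ip (ell2 X) f f = 0"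
  proof -
    have "l2norm f = 0" using that f' by (simp add: scal_self[OF f'])
    then have "cmod (f v) \<le> 0" for v using cmod_le_l2norm[OF f', of v] by simp
    then show ?thesis by (simp add: ell2_def fun_eq_iff)
  qed
  assume g: "g \<in> carrier (ell2 X)"
  show "ip (ell2 X) g f = cnj (ip (ell2 X) f g)" using f' g by (simp add: scal_commute[of g f])
  have "c \<odot>\<^bsub>ell2 X\<^esub> f = (\<lambda>v. c * f v)" by (simp add: ell2_def)
  then show "ip (ell2 X) (c \<odot>\<^bsub>ell2 X\<^esub> f) g = c * ip (ell2 X) f g"
    using f' by (simp add: scal_smult_left)
  assume h: "h \<in> carrier (ell2 X)"
  have "f \<oplus>\<^bsub>ell2 X\<^esub> g = (\<lambda>v. f v + g v)" by (simp add: ell2_def)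
  then show "ip (ell2 X) (f \<oplus>\<^bsub>ell2 X\<^esub> g) h = ip (ell2 X) f h + ip (ell2 X) g h"
    using f' g h by (simp add: scal_add_left)
next
  show "Metric_space.mcomplete (carrier (ell2 X)) (hdist (ell2 X))"
    by (simp add: mcomplete_ell2)
qed

text \<open>Finite truncations of a square summable function converge to it.\<close>

lemma finite_support_dense:
  assumes "D \<subseteq> ell2_set X"
    and fin: "\<And>f. finite {v. f v \<noteq> 0} \<Longrightarrow> (\<And>v. v \<notin> X \<Longrightarrow> f v = 0) \<Longrightarrow> f \<in> D"
  shows "htopology (ell2 X) closure_of D = carrier (ell2 X)"
proof -
  interpret Metric_space "ell2_set X" "hdist (ell2 X)" by (rule Metric_space_ell2)
  have "\<exists>g\<in>D. g \<in> mball f r" if f: "f \<in> ell2_set X" and r: "r > 0" for f r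
  proof -
    let ?S = "\<lambda>F. (\<Sum>v\<in>F. (cmod (f v))\<^sup>2)"
    \<comment> \<open>The part of \<open>f\<close> outside \<open>F\<close> has norm at most \<open>r / 2\<close>.\<close>
    obtain F where F: "finite F" and d: "dist (?S F) (\<Sum>\<^sub>\<infinity>v. (cmod (f v))\<^sup>2) \<le> (r/2)\<^sup>2"
      using infsum_finite_approximation[OF ell2_summable[OF f], of "(r/2)\<^sup>2"] r by auto
    define g where "g = (\<lambda>v. if v \<in> F then f v else 0)"
    have "g \<in> D"
      by (rule fin) (use F f in \<open>auto simp: g_def ell2_off intro: finite_subset[of _ F]\<close>)
    then have g: "g \<in> ell2_set X" using assms(1) by blast
    have "L2_set (\<lambda>v. cmod (f v - g v)) G \<le> r/2" if G: "finite G" for G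
    proof -
      have "(\<Sum>v\<in>G. (cmod (f v - g v))\<^sup>2) = (\<Sum>v\<in>G - F. (cmod (f v))\<^sup>2)"
        by (rule sum.mono_neutral_cong_right) (use G in \<open>auto simp: g_def\<close>)
      also have "\<dots> = ?S (G \<union> F) - ?S F"
        using sum.subset_diff[of F "G \<union> F" "\<lambda>v. (cmod (f v))\<^sup>2"] F G by (simp add: Un_Diff)
      also have "\<dots> \<le> (\<Sum>\<^sub>\<infinity>v. (cmod (f v))\<^sup>2) - ?S F"
        using F G by (intro diff_right_mono finite_sum_le_infsum ell2_summable[OF f]) auto
      also have "\<dots> \<le> (r/2)\<^sup>2" using d by (auto simp: dist_real_def)
      finally show ?thesis unfolding L2_set_def using r
        by (intro real_le_lsqrt) (auto simp: sum_nonneg)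
    qed
    moreover have "f v - g v = 0" if "v \<notin> X" for v using that f g by (simp add: ell2_off)
    ultimately have "l2norm (\<lambda>v. f v - g v) \<le> r/2"
      using ell2_boundedI(2)[of X "\<lambda>v. f v - g v" "r/2"] by blast
    then have "g \<in> mball f r" using r f g by (simp add: in_mball hdist_ell2)
    with \<open>g \<in> D\<close> show ?thesis by blast
  qed
  then show ?thesis by (auto simp: metric_closure_of)
qed

text \<open>This makes closedness of an operator a matter of testing against vectors.\<close>

lemma continuous_map_scal:
  assumes z: "z \<in> ell2_set X"
  shows "continuous_map (htopology (ell2 X)) euclidean (\<lambda>f. scal f z)"
proof -
  interpret Metric_space "ell2_set X" "hdist (ell2 X)" by (rule Metric_space_ell2)
  have "\<exists>d>0. \<forall>g. g \<in> ell2_set X \<and> hdist (ell2 X) f g < d \<longrightarrow> dist (scal f z) (scal g z) < e"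
    if f: "f \<in> ell2_set X" and e: "e > 0" for f e
  proof (intro exI[of _ "e / (l2norm z + 1)"] conjI allI impI)
    show d: "e / (l2norm z + 1) > 0" using e by (simp add: add_nonneg_pos)
    fix g assume "g \<in> ell2_set X \<and> hdist (ell2 X) f g < e / (l2norm z + 1)"
    then have g: "g \<in> ell2_set X" and l: "l2norm (\<lambda>v. f v - g v) < e / (l2norm z + 1)"
      using f by (auto simp: hdist_ell2)
    have "scal (\<lambda>v. f v - g v) z = scal f z - scal g z"
      using scal_add_left[OF f ell2_uminus[OF g] z] scal_smult_left[of "-1" g z] by simp
    then have "dist (scal f z) (scal g z) \<le> l2norm (\<lambda>v. f v - g v) * l2norm z"
      using ell2_product(2)[OF ell2_diff[OF f g] z] by (simp add: dist_norm)
    also have "\<dots> \<le> l2norm (\<lambda>v. f v - g v) * (l2norm z + 1)"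
      by (intro mult_left_mono) auto
    also have "\<dots> < e" using l by (simp add: pos_less_divide_eq add_nonneg_pos)
    finally show "dist (scal f z) (scal g z) < e" .
  qed
  then show ?thesis
    using metric_continuous_map[OF Met_TC.Metric_space_axioms, of "\<lambda>f. scal f z"] by simp
qed

section \<open>Products of a unitary and a commuting multiplication operator\<close>

definition mult_domain :: "'x set \<Rightarrow> ('x \<Rightarrow> real) \<Rightarrow> ('x \<Rightarrow> complex) set" where
  "mult_domain X h = {f \<in> ell2_set X. (\<lambda>x. of_real (h x) * f x) \<in> ell2_set X}"

definition unitary_times_mult ::
    "'x set \<Rightarrow> ('x \<Rightarrow> real) \<Rightarrow> (('x \<Rightarrow> complex) \<Rightarrow> ('x \<Rightarrow> complex)) \<Rightarrow> (('x \<Rightarrow> complex) \<rightharpoonup> ('x \<Rightarrow> complex))"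
  where
  "unitary_times_mult X h U = (\<lambda>f. if f \<in> mult_domain X h then Some (U (\<lambda>x. of_real (h x) * f x)) else None)"

text \<open>The inverse \<open>U'\<close> of the unitary \<open>U\<close> is a parameter because the dilations below give it
  explicitly.\<close>

locale commuting_unitary =
  fixes X :: "'x set" and h :: "'x \<Rightarrow> real" and U U' :: "('x \<Rightarrow> complex) \<Rightarrow> ('x \<Rightarrow> complex)"
  assumes U_closed: "f \<in> ell2_set X \<Longrightarrow> U f \<in> ell2_set X"
    and U'_closed: "f \<in> ell2_set X \<Longrightarrow> U' f \<in> ell2_set X"
    and U_add: "f \<in> ell2_set X \<Longrightarrow> g \<in> ell2_set X \<Longrightarrow> U (\<lambda>x. f x + g x) = (\<lambda>x. U f x + U g x)"
    and U_smult: "f \<in> ell2_set X \<Longrightarrow> U (\<lambda>x. c * f x) = (\<lambda>x. c * U f x)"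
    and U_adjoint: "f \<in> ell2_set X \<Longrightarrow> g \<in> ell2_set X \<Longrightarrow> scal (U f) g = scal f (U' g)"
    and U'_U: "f \<in> ell2_set X \<Longrightarrow> U' (U f) = f"
    and U_U': "f \<in> ell2_set X \<Longrightarrow> U (U' f) = f"
    and U_mult: "f \<in> mult_domain X h \<Longrightarrow> U (\<lambda>x. of_real (h x) * f x) = (\<lambda>x. of_real (h x) * U f x)"
    and U'_mult: "f \<in> mult_domain X h \<Longrightarrow> U' (\<lambda>x. of_real (h x) * f x) = (\<lambda>x. of_real (h x) * U' f x)"
begin

abbreviation "N \<equiv> unitary_times_mult X h U"

abbreviation "D \<equiv> mult_domain X h"

lemma D_ell2: "f \<in> D \<Longrightarrow> f \<in> ell2_set X"
  by (simp add: mult_domain_def)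

lemma hD_ell2: "f \<in> D \<Longrightarrow> (\<lambda>x. of_real (h x) * f x) \<in> ell2_set X"
  by (simp add: mult_domain_def)

lemma dom_N: "dom N = D"
  by (auto simp: unitary_times_mult_def split: if_splits)

lemma the_N: "f \<in> D \<Longrightarrow> the (N f) = U (\<lambda>x. of_real (h x) * f x)"
  by (simp add: unitary_times_mult_def)

lemma U_preserves_D: "f \<in> D \<Longrightarrow> U f \<in> D"
  using U_closed[of f] U_closed[of "\<lambda>x. of_real (h x) * f x"] U_mult[of f] by (simp add: mult_domain_def)

lemma U'_preserves_D: "f \<in> D \<Longrightarrow> U' f \<in> D"
  using U'_closed[of f] U'_closed[of "\<lambda>x. of_real (h x) * f x"] U'_mult[of f] by (simp add: mult_domain_def)

lemma finite_support_in_D: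
  assumes "finite {x. f x \<noteq> 0}" "\<And>x. x \<notin> X \<Longrightarrow> f x = 0"
  shows "f \<in> D"
  using assms unfolding mult_domain_def
  by (auto intro!: ell2_finite_support intro: finite_subset[of _ "{x. f x \<noteq> 0}"])

lemma scal_single: "scal (\<lambda>x. if x = y then 1 else 0) g = cnj (g y)"
proof -
  have "scal (\<lambda>x. if x = y then 1 else 0) g = (\<Sum>\<^sub>\<infinity>x\<in>{y}. cnj (g x))"
    unfolding scal_def by (rule infsum_cong_neutral) auto
  then show ?thesis by simp
qed

lemma single_in_D: "y \<in> X \<Longrightarrow> (\<lambda>x. if x = y then 1 else 0) \<in> D"
  by (rule finite_support_in_D) (auto intro: finite_subset[of _ "{y}"])

lemma linear_operator_N: "linear_operator (ell2 X) N"
proof -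
  interpret M: Module.module complex_ring "ell2 X" by (rule module_ell2)
  have add: "f \<oplus>\<^bsub>ell2 X\<^esub> g = (\<lambda>x. f x + g x)" and smult: "c \<odot>\<^bsub>ell2 X\<^esub> f = (\<lambda>x. c * f x)"
    and zero: "\<zero>\<^bsub>ell2 X\<^esub> = (\<lambda>x. 0)" for f g c
    by (auto simp: ell2_def)
  have D_add: "(\<lambda>x. f x + g x) \<in> D" if "f \<in> D" "g \<in> D" for f g
    using that ell2_add(1)[of f X g] ell2_add(1)[of "\<lambda>x. of_real (h x) * f x" X "\<lambda>x. of_real (h x) * g x"]
    by (simp add: mult_domain_def distrib_left)
  have D_smult: "(\<lambda>x. c * f x) \<in> D" if "f \<in> D" for f c
    using that ell2_smult[of f X c] ell2_smult[of "\<lambda>x. of_real (h x) * f x" X c]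
    by (simp add: mult_domain_def mult.left_commute)
  have "submodule D complex_ring (ell2 X)"
  proof (rule M.submoduleI)
    show "D \<subseteq> carrier (ell2 X)" by (auto simp: D_ell2)
    show "\<zero>\<^bsub>ell2 X\<^esub> \<in> D" by (simp add: zero mult_domain_def ell2_zero)
    fix f assume f: "f \<in> D"
    have "\<ominus>\<^bsub>ell2 X\<^esub> f = (\<lambda>x. (-1) * f x)"
      by (rule M.minus_equality) (use f in \<open>auto simp: add zero D_ell2 ell2_uminus\<close>)
    then show "\<ominus>\<^bsub>ell2 X\<^esub> f \<in> D" using D_smult[OF f, of "-1"] by simp
  qed (auto simp: add smult D_add D_smult)
  moreover have "ran N \<subseteq> carrier (ell2 X)"
    by (auto simp: ran_def unitary_times_mult_def U_closed hD_ell2 split: if_splits)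
  moreover have "the (N (\<lambda>x. f x + g x)) = (\<lambda>x. the (N f) x + the (N g) x)" if "f \<in> D" "g \<in> D" for f g
    using that U_add[OF hD_ell2 hD_ell2, of f g] by (simp add: the_N D_add distrib_left)
  moreover have "the (N (\<lambda>x. c * f x)) = (\<lambda>x. c * the (N f) x)" if "f \<in> D" for f c
    using that U_smult[OF hD_ell2, of f c] by (simp add: the_N D_smult mult.left_commute)
  ultimately show ?thesis
    unfolding linear_operator_def dom_N add smult by simp
qed

lemma densely_defined_N: "densely_defined (ell2 X) N"
  unfolding densely_defined_def dom_N
  by (rule finite_support_dense) (use D_ell2 finite_support_in_D in auto)

text \<open>Applying \<open>U'\<close> to both sides of \<open>g = U (h f)\<close> leaves a condition on \<open>f\<close> and \<open>g\<close> alone: that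
  \<open>h f\<close> is square summable follows from it.\<close>

lemma graph_N:
  "Map.graph N = {p \<in> ell2_set X \<times> ell2_set X. \<forall>x\<in>X. U' (snd p) x = of_real (h x) * fst p x}"
proof -
  have "N f = Some g \<longleftrightarrow> f \<in> ell2_set X \<and> g \<in> ell2_set X \<and> (\<forall>x\<in>X. U' g x = of_real (h x) * f x)"
    for f g
  proof
    assume "N f = Some g"
    then have f: "f \<in> D" and g: "g = U (\<lambda>x. of_real (h x) * f x)"
      by (auto simp: unitary_times_mult_def split: if_splits)
    show "f \<in> ell2_set X \<and> g \<in> ell2_set X \<and> (\<forall>x\<in>X. U' g x = of_real (h x) * f x)"
      unfolding g using U_closed[OF hD_ell2[OF f]] U'_U[OF hD_ell2[OF f]] D_ell2[OF f] by simp
  next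
    assume a: "f \<in> ell2_set X \<and> g \<in> ell2_set X \<and> (\<forall>x\<in>X. U' g x = of_real (h x) * f x)"
    then have f: "f \<in> ell2_set X" and g: "g \<in> ell2_set X" by auto
    have "U' g x = of_real (h x) * f x" for x
      using a ell2_off[OF f, of x] ell2_off[OF U'_closed[OF g], of x] by (cases "x \<in> X") auto
    then have eq: "(\<lambda>x. of_real (h x) * f x) = U' g" by auto
    then have "f \<in> D" using f U'_closed[OF g] by (simp add: mult_domain_def)
    then show "N f = Some g"
      using U_U'[OF g] by (simp add: unitary_times_mult_def eq)
  qed
  then show ?thesis by (auto simp: graph_def)
qed

text \<open>Each of the coordinate equations for the graph compares two continuous functionals.\<close>

lemma closed_operator_N:
  assumes "X \<noteq> {}"
  shows "closed_operator (ell2 X) N"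
proof -
  interpret Metric_space "ell2_set X" "hdist (ell2 X)" by (rule Metric_space_ell2)
  let ?e = "\<lambda>y x. if x = y then 1 else 0 :: complex"
  let ?T = "prod_topology (htopology (ell2 X)) (htopology (ell2 X))"
  have "closedin ?T {p \<in> topspace ?T. scal (snd p) (U (?e x)) = of_real (h x) * scal (fst p) (?e x)}"
    if "x \<in> X" for x
  proof (rule closedin_continuous_maps_eq)
    have e: "?e x \<in> ell2_set X" using single_in_D[OF that] by (rule D_ell2)
    show "Hausdorff_space (euclidean :: complex topology)" by simp
    show "continuous_map ?T euclidean (\<lambda>p. scal (snd p) (U (?e x)))"
      using continuous_map_compose[OF continuous_map_snd continuous_map_scal[OF U_closed[OF e]]]
      by (simp add: o_def)
    have "continuous_map ?T euclidean (\<lambda>p. scal (fst p) (?e x))"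
      using continuous_map_compose[OF continuous_map_fst continuous_map_scal[OF e]]
      by (simp add: o_def)
    moreover have "continuous_map euclidean euclidean (\<lambda>z. complex_of_real (h x) * z)"
      unfolding continuous_map_iff_continuous2 by (intro continuous_intros)
    ultimately show "continuous_map ?T euclidean (\<lambda>p. of_real (h x) * scal (fst p) (?e x))"
      by (rule continuous_map_compose[unfolded o_def])
  qed
  then have "closedin ?T (\<Inter>x\<in>X. {p \<in> topspace ?T. scal (snd p) (U (?e x)) = of_real (h x) * scal (fst p) (?e x)})"
    by (rule closedin_INT[OF assms])
  also have "(\<Inter>x\<in>X. {p \<in> topspace ?T. scal (snd p) (U (?e x)) = of_real (h x) * scal (fst p) (?e x)}) = Map.graph N"
  proof -
    have s1: "scal f (?e x) = f x" for f x
      using scal_commute[of f "?e x"] scal_single[of x f] by simp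
    have s2: "scal g (U (?e x)) = U' g x" if "g \<in> ell2_set X" "x \<in> X" for g x
      using U_adjoint[OF D_ell2[OF single_in_D[OF that(2)]] that(1)] scal_single[of x "U' g"]
        scal_commute[of g "U (?e x)"] by simp
    have "{p \<in> topspace ?T. scal (snd p) (U (?e x)) = of_real (h x) * scal (fst p) (?e x)} =
        {p \<in> ell2_set X \<times> ell2_set X. U' (snd p) x = of_real (h x) * fst p x}"
      if "x \<in> X" for x
      using that by (intro Collect_cong conj_cong) (auto simp: s1 s2 topspace_prod_topology)
    then have "(\<Inter>x\<in>X. {p \<in> topspace ?T. scal (snd p) (U (?e x)) = of_real (h x) * scal (fst p) (?e x)}) =
        (\<Inter>x\<in>X. {p \<in> ell2_set X \<times> ell2_set X. U' (snd p) x = of_real (h x) * fst p x})"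
      by (rule INF_cong[OF refl])
    also have "\<dots> = Map.graph N" unfolding graph_N using assms by blast
    finally show ?thesis .
  qed
  finally show ?thesis by (simp add: closed_operator_def)
qed

text \<open>Testing against the unit vectors forces \<open>h (U' g)\<close> to be the value of the adjoint
  at \<open>g\<close>.\<close>

lemma adjoint_N:
  "adjoint_op (ell2 X) N = (\<lambda>g. if g \<in> D then Some (U' (\<lambda>x. of_real (h x) * g x)) else None)"
proof
  fix g
  let ?e = "\<lambda>y x. if x = y then 1 else 0 :: complex"
  have z_eq: "z = (\<lambda>x. of_real (h x) * U' g x)"
    if g: "g \<in> ell2_set X" and z: "z \<in> ell2_set X"
      and eq: "\<forall>f\<in>D. scal (U (\<lambda>x. of_real (h x) * f x)) g = scal f z" for z
  proof
    fix y
    show "z y = of_real (h y) * U' g y"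
    proof (cases "y \<in> X")
      case True
      then have e: "?e y \<in> D" by (rule single_in_D)
      have "cnj (z y) = scal (U (\<lambda>x. of_real (h x) * ?e y x)) g"
        using eq e scal_single[of y z] by simp
      also have "\<dots> = scal (\<lambda>x. of_real (h y) * ?e y x) (U' g)"
      proof -
        have "(\<lambda>x. of_real (h x) * ?e y x) = (\<lambda>x. complex_of_real (h y) * ?e y x)" by auto
        then show ?thesis using U_adjoint[OF hD_ell2[OF e] g] by simp
      qed
      also have "\<dots> = of_real (h y) * cnj (U' g y)"
        by (simp only: scal_smult_left scal_single)
      finally show ?thesis by (metis complex_cnj_cnj complex_cnj_complex_of_real complex_cnj_mult)
    qed (use ell2_off[OF z] ell2_off[OF U'_closed[OF g]] in auto)
  qed
  let ?P = "\<lambda>z. z \<in> ell2_set X \<and> (\<forall>f\<in>D. scal (U (\<lambda>x. of_real (h x) * f x)) g = scal f z)"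
  have adj: "?P (U' (\<lambda>x. of_real (h x) * g x))" if g: "g \<in> D"
  proof (intro conjI ballI U'_closed[OF hD_ell2[OF g]])
    fix f assume f: "f \<in> D"
    have "scal (U (\<lambda>x. of_real (h x) * f x)) g = scal (\<lambda>x. of_real (h x) * f x) (U' g)"
      by (rule U_adjoint[OF hD_ell2[OF f] D_ell2[OF g]])
    also have "\<dots> = scal f (\<lambda>x. of_real (h x) * U' g x)"
      unfolding scal_def by (simp add: mult_ac)
    finally show "scal (U (\<lambda>x. of_real (h x) * f x)) g = scal f (U' (\<lambda>x. of_real (h x) * g x))"
      using U'_mult[OF g] by simp
  qed
  have dom: "g \<in> D" if g: "g \<in> ell2_set X" and z: "?P z" for z
  proof -
    have "U' g \<in> D" using z_eq[OF g, of z] z U'_closed[OF g] by (auto simp: mult_domain_def)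
    from U_preserves_D[OF this] show ?thesis by (simp add: U_U'[OF g])
  qed
  have ip: "(\<forall>f\<in>D. ip (ell2 X) (the (N f)) g = ip (ell2 X) f z) \<longleftrightarrow>
      (\<forall>f\<in>D. scal (U (\<lambda>x. of_real (h x) * f x)) g = scal f z)" for z
    by (simp add: the_N ell2_ip_eq[OF D_ell2] ell2_ip_eq[OF U_closed[OF hD_ell2]])
  have uniq: "z = U' (\<lambda>x. of_real (h x) * g x)" if "g \<in> D" "?P z" for z
    using z_eq[OF D_ell2[OF that(1)], of z] z_eq[OF D_ell2[OF that(1)], of "U' (\<lambda>x. of_real (h x) * g x)"]
      that adj by simp
  show "adjoint_op (ell2 X) N g = (if g \<in> D then Some (U' (\<lambda>x. of_real (h x) * g x)) else None)"
  proof (cases "g \<in> D")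
    case True
    have "(THE z. ?P z) = U' (\<lambda>x. of_real (h x) * g x)"
      by (rule the_equality, rule adj[OF True], rule uniq[OF True])
    moreover have "g \<in> ell2_set X \<and> (\<exists>z\<in>ell2_set X. \<forall>f\<in>D. scal (U (\<lambda>x. of_real (h x) * f x)) g = scal f z)"
      using adj[OF True] D_ell2[OF True] by blast
    ultimately show ?thesis
      unfolding adjoint_op_def dom_N carrier_ell2 ip by (simp only: True if_True simp_thms)
  next
    case False
    then have "\<not> (g \<in> ell2_set X \<and> (\<exists>z\<in>ell2_set X. \<forall>f\<in>D. scal (U (\<lambda>x. of_real (h x) * f x)) g = scal f z))"
      using dom by blast
    then show ?thesis
      unfolding adjoint_op_def dom_N carrier_ell2 ip by (simp only: False if_False simp_thms)
  qed
qed

text \<open>Both products are multiplication by \<open>h\<^sup>2\<close>, because \<open>U\<close> and \<open>U'\<close>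
  preserve the domain of multiplication by \<open>h\<close>.\<close>

lemma N_commutes_adjoint: "N \<circ>\<^sub>m adjoint_op (ell2 X) N = adjoint_op (ell2 X) N \<circ>\<^sub>m N"
proof
  fix f
  show "(N \<circ>\<^sub>m adjoint_op (ell2 X) N) f = (adjoint_op (ell2 X) N \<circ>\<^sub>m N) f"
  proof (cases "f \<in> D")
    case True
    let ?g = "\<lambda>x. of_real (h x) * f x"
    have g: "?g \<in> ell2_set X" by (rule hD_ell2[OF True])
    have iff: "U ?g \<in> D \<longleftrightarrow> ?g \<in> D" "U' ?g \<in> D \<longleftrightarrow> ?g \<in> D"
      using U_preserves_D U'_preserves_D U'_U[OF g] U_U'[OF g] by metis+
    have "U (\<lambda>x. of_real (h x) * U' ?g x) = (\<lambda>x. of_real (h x) * ?g x)" if "?g \<in> D"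
      using U'_mult[OF that] U_U'[OF hD_ell2[OF that]] by simp
    moreover have "U' (\<lambda>x. of_real (h x) * U ?g x) = (\<lambda>x. of_real (h x) * ?g x)" if "?g \<in> D"
      using U_mult[OF that] U'_U[OF hD_ell2[OF that]] by simp
    ultimately show ?thesis
      unfolding map_comp_def adjoint_N using True iff by (simp add: unitary_times_mult_def)
  next
    case False
    then show ?thesis unfolding map_comp_def adjoint_N by (simp add: unitary_times_mult_def)
  qed
qed

lemma normal_operator_N: "X \<noteq> {} \<Longrightarrow> normal_operator (ell2 X) N"
  by (simp add: normal_operator_def linear_operator_N closed_operator_N densely_defined_N
      N_commutes_adjoint)

end

section \<open>Weighted shifts along a map\<close>

text \<open>Sums with values in the extended nonnegative reals can be interchanged and compared without
  side conditions on summability.\<close>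

abbreviation nsum :: "('x \<Rightarrow> ennreal) \<Rightarrow> ennreal" where
  "nsum f \<equiv> \<integral>\<^sup>+x. f x \<partial>count_space UNIV"

lemma nsum_finite_iff_summable:
  fixes f :: "'x \<Rightarrow> real"
  assumes "\<And>x. 0 \<le> f x"
  shows "nsum (\<lambda>x. ennreal (f x)) < \<infinity> \<longleftrightarrow> f summable_on UNIV"
proof -
  have "f summable_on UNIV \<longleftrightarrow> integrable (count_space UNIV) f"
    using assms abs_summable_equivalent[of f UNIV] by (simp add: abs_summable_on_def)
  also have "\<dots> \<longleftrightarrow> nsum (\<lambda>x. ennreal (f x)) < \<infinity>"
    using assms by (simp add: integrable_iff_bounded)
  finally show ?thesis by simp
qed

lemma nsum_swap:
  "nsum (\<lambda>x. nsum (\<lambda>y. F x y)) = nsum (\<lambda>y. nsum (\<lambda>x. F x y))"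
  using nn_integral_fst_count_space[of "\<lambda>(x, y). F x y"]
    nn_integral_snd_count_space[of "\<lambda>(x, y). F x y"] by simp

lemma nsum_single:
  assumes "\<And>x. x \<noteq> a \<Longrightarrow> f x = 0" shows "nsum f = f a"
  using assms nn_integral_count_space'[of "{a}" UNIV f] by simp

lemma ell2_set_iff_nsum:
  "f \<in> ell2_set X \<longleftrightarrow>
    (\<forall>x. x \<notin> X \<longrightarrow> f x = 0) \<and> nsum (\<lambda>x. ennreal ((cmod (f x))\<^sup>2)) < \<infinity>"
  unfolding ell2_set_alt by (simp only: nsum_finite_iff_summable zero_le_power2)

lemma nsum_eq_infsum:
  fixes f :: "'x \<Rightarrow> real"
  assumes "\<And>x. 0 \<le> f x" "f summable_on UNIV"
  shows "nsum (\<lambda>x. ennreal (f x)) = ennreal (infsum f UNIV)"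
  using assms abs_summable_equivalent[of f UNIV] nn_integral_conv_infsetsum[of f UNIV]
    infsetsum_infsum[of f UNIV] by simp

lemma nsum_eq_l2norm:
  assumes "f \<in> ell2_set X"
  shows "nsum (\<lambda>x. ennreal ((cmod (f x))\<^sup>2)) = ennreal ((l2norm f)\<^sup>2)"
  using nsum_eq_infsum[of "\<lambda>x. (cmod (f x))\<^sup>2"] ell2_summable[OF assms]
  by (simp add: l2norm_def infsum_nonneg)

text \<open>A common form for the shift on a tree and for its copies on the fibres of a family of trees.\<close>

definition map_shift :: "'x set \<Rightarrow> ('x \<Rightarrow> 'x) \<Rightarrow> ('x \<Rightarrow> complex) \<Rightarrow> ('x \<Rightarrow> complex) \<Rightarrow> 'x \<Rightarrow> complex"
  where "map_shift A p w f = (\<lambda>y. if y \<in> A then w y * f (p y) else 0)"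

text \<open>Each \<open>y\<close> in \<open>A\<close> receives its value from the single point \<open>p y\<close>, so sorting the sum by the value
  of \<open>p\<close> expresses it through the squared weights on the fibres of \<open>p\<close>.\<close>

lemma nsum_map_shift:
  "nsum (\<lambda>y. ennreal ((cmod (map_shift A p w f y))\<^sup>2) * \<phi> y) =
    nsum (\<lambda>x. ennreal ((cmod (f x))\<^sup>2) *
      nsum (\<lambda>y. if y \<in> A \<and> p y = x then ennreal ((cmod (w y))\<^sup>2) * \<phi> y else 0))"
    (is "_ = nsum (\<lambda>x. ?f x * nsum (?G x))")
proof -
  have "nsum (\<lambda>x. ?f x * nsum (?G x)) = nsum (\<lambda>x. nsum (\<lambda>y. ?f x * ?G x y))"
    by (simp add: nn_integral_cmult)
  also have "\<dots> = nsum (\<lambda>y. nsum (\<lambda>x. ?f x * ?G x y))"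
    by (rule nsum_swap)
  also have "\<dots> = nsum (\<lambda>y. ennreal ((cmod (map_shift A p w f y))\<^sup>2) * \<phi> y)"
  proof (rule nn_integral_cong)
    fix y
    have "nsum (\<lambda>x. ?f x * ?G x y) = ?f (p y) * ?G (p y) y"
      by (rule nsum_single) auto
    also have "\<dots> = ennreal ((cmod (map_shift A p w f y))\<^sup>2) * \<phi> y"
      by (simp add: map_shift_def norm_mult power_mult_distrib ennreal_mult mult_ac)
    finally show "nsum (\<lambda>x. ?f x * ?G x y) = ennreal ((cmod (map_shift A p w f y))\<^sup>2) * \<phi> y" .
  qed
  finally show ?thesis by simp
qed

locale isometric_shift =
  fixes Y A :: "'x set" and p :: "'x \<Rightarrow> 'x" and w :: "'x \<Rightarrow> complex"
  assumes A_subset: "A \<subseteq> Y"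
    and p_closed: "y \<in> A \<Longrightarrow> p y \<in> Y"
    and weights: "x \<in> Y \<Longrightarrow> nsum (\<lambda>y. if y \<in> A \<and> p y = x then ennreal ((cmod (w y))\<^sup>2) else 0) = 1"
begin

abbreviation "T \<equiv> map_shift A p w"

text \<open>The adjoint of \<open>T\<close>.\<close>

definition T' :: "('x \<Rightarrow> complex) \<Rightarrow> 'x \<Rightarrow> complex" where
  "T' g = (\<lambda>x. if x \<in> Y then (\<Sum>\<^sub>\<infinity>y\<in>{y\<in>A. p y = x}. cnj (w y) * g y) else 0)"

definition fibre_weight :: "'x \<Rightarrow> 'x \<Rightarrow> complex" where
  "fibre_weight x = (\<lambda>y. if y \<in> A \<and> p y = x then w y else 0)"

lemma nsum_T:
  assumes "\<And>x. x \<notin> Y \<Longrightarrow> f x = 0"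
  shows "nsum (\<lambda>y. ennreal ((cmod (T f y))\<^sup>2)) = nsum (\<lambda>x. ennreal ((cmod (f x))\<^sup>2))"
proof -
  have "ennreal ((cmod (f x))\<^sup>2) * nsum (\<lambda>y. if y \<in> A \<and> p y = x then ennreal ((cmod (w y))\<^sup>2) else 0)
      = ennreal ((cmod (f x))\<^sup>2)" for x
    using weights[of x] assms[of x] by (cases "x \<in> Y") auto
  then show ?thesis
    using nsum_map_shift[of A p w f "\<lambda>_. 1", unfolded mult_1_right] by simp
qed

lemma T_closed: "f \<in> ell2_set Y \<Longrightarrow> T f \<in> ell2_set Y"
  using A_subset by (auto simp: ell2_set_iff_nsum nsum_T) (auto simp: map_shift_def)

lemma nsum_fibre_weight:
  assumes "x \<in> Y" shows "nsum (\<lambda>y. ennreal ((cmod (fibre_weight x y))\<^sup>2)) = 1"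
  unfolding weights[OF assms, symmetric] by (rule nn_integral_cong) (simp add: fibre_weight_def)

lemma fibre_weight_ell2: "x \<in> Y \<Longrightarrow> fibre_weight x \<in> ell2_set UNIV"
  by (simp add: ell2_set_iff_nsum nsum_fibre_weight)

lemma l2norm_fibre_weight: "x \<in> Y \<Longrightarrow> l2norm (fibre_weight x) = 1"
  using nsum_eq_l2norm[OF fibre_weight_ell2, of x] l2norm_nonneg[of "fibre_weight x"]
  by (auto simp: nsum_fibre_weight power2_eq_1_iff simp del: l2norm_nonneg)

lemma T'_eq_scal: "x \<in> Y \<Longrightarrow> T' g x = scal g (fibre_weight x)"
  unfolding T'_def scal_def
  by (simp, rule infsum_cong_neutral) (auto simp: fibre_weight_def mult.commute)

text \<open>The Cauchy--Schwarz inequality on each fibre, where the weights have norm one.\<close>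

lemma T'_closed:
  assumes g: "g \<in> ell2_set Y" shows "T' g \<in> ell2_set Y"
proof -
  define r where "r x = (\<lambda>y. if y \<in> A \<and> p y = x then g y else 0)" for x
  have r: "r x \<in> ell2_set UNIV" for x
  proof -
    have "nsum (\<lambda>y. ennreal ((cmod (r x y))\<^sup>2)) \<le> nsum (\<lambda>y. ennreal ((cmod (g y))\<^sup>2))"
      by (rule nn_integral_mono) (auto simp: r_def)
    with g show ?thesis by (auto simp: ell2_set_iff_nsum)
  qed
  have "ennreal ((cmod (T' g x))\<^sup>2) \<le> nsum (\<lambda>y. ennreal ((cmod (r x y))\<^sup>2))" for x
  proof (cases "x \<in> Y")
    case True
    have "T' g x = scal (r x) (fibre_weight x)"
      unfolding T'_eq_scal[OF True] scal_def by (rule infsum_cong) (auto simp: r_def fibre_weight_def)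
    then have "cmod (T' g x) \<le> l2norm (r x)"
      using ell2_product(2)[OF r fibre_weight_ell2[OF True], of x] l2norm_fibre_weight[OF True] by simp
    then have "(cmod (T' g x))\<^sup>2 \<le> (l2norm (r x))\<^sup>2" by (intro power_mono) auto
    then have "ennreal ((cmod (T' g x))\<^sup>2) \<le> ennreal ((l2norm (r x))\<^sup>2)" by (rule ennreal_leI)
    also have "\<dots> = nsum (\<lambda>y. ennreal ((cmod (r x y))\<^sup>2))" by (rule nsum_eq_l2norm[OF r, symmetric])
    finally show ?thesis .
  qed (simp add: T'_def)
  then have "nsum (\<lambda>x. ennreal ((cmod (T' g x))\<^sup>2)) \<le> nsum (\<lambda>x. nsum (\<lambda>y. ennreal ((cmod (r x y))\<^sup>2)))"
    by (intro nn_integral_mono)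
  also have "\<dots> = nsum (\<lambda>y. nsum (\<lambda>x. ennreal ((cmod (r x y))\<^sup>2)))"
    by (rule nsum_swap)
  also have "\<dots> \<le> nsum (\<lambda>y. ennreal ((cmod (g y))\<^sup>2))"
  proof (rule nn_integral_mono)
    fix y
    have "nsum (\<lambda>x. ennreal ((cmod (r x y))\<^sup>2)) = ennreal ((cmod (r (p y) y))\<^sup>2)"
      by (rule nsum_single) (auto simp: r_def)
    then show "nsum (\<lambda>x. ennreal ((cmod (r x y))\<^sup>2)) \<le> ennreal ((cmod (g y))\<^sup>2)"
      by (auto simp: r_def)
  qed
  finally show ?thesis using g by (auto simp: ell2_set_iff_nsum T'_def)
qed

lemma T_add: "T (\<lambda>x. f x + g x) = (\<lambda>x. T f x + T g x)"
  and T_smult: "T (\<lambda>x. c * f x) = (\<lambda>x. c * T f x)"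
  by (auto simp: map_shift_def algebra_simps)

lemma T'_add:
  assumes "f \<in> ell2_set Y" "g \<in> ell2_set Y"
  shows "T' (\<lambda>x. f x + g x) = (\<lambda>x. T' f x + T' g x)"
proof
  have e: "f \<in> ell2_set UNIV" "g \<in> ell2_set UNIV" using assms by (auto simp: ell2_set_alt)
  show "T' (\<lambda>x. f x + g x) x = T' f x + T' g x" for x
    by (cases "x \<in> Y")
      (simp_all add: T'_eq_scal scal_add_left[OF e fibre_weight_ell2], simp add: T'_def)
qed

lemma T'_smult: "T' (\<lambda>x. c * f x) = (\<lambda>x. c * T' f x)"
proof
  show "T' (\<lambda>x. c * f x) x = c * T' f x" for x
    by (cases "x \<in> Y") (simp_all add: T'_eq_scal scal_smult_left, simp add: T'_def)
qed

text \<open>On the fibre over \<open>x\<close>, the function \<open>T f\<close> is \<open>f x\<close> times the unit vector of weights, and \<open>T'\<close>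
  takes the inner product with this vector.\<close>

lemma T'_T:
  assumes "f \<in> ell2_set Y" shows "T' (T f) = f"
proof
  fix x
  show "T' (T f) x = f x"
  proof (cases "x \<in> Y")
    case True
    have "T' (T f) x = scal (\<lambda>y. f x * fibre_weight x y) (fibre_weight x)"
      unfolding T'_eq_scal[OF True] scal_def
      by (rule infsum_cong) (auto simp: map_shift_def fibre_weight_def)
    also have "\<dots> = f x"
      by (simp add: scal_smult_left scal_self[OF fibre_weight_ell2[OF True]] l2norm_fibre_weight[OF True])
    finally show ?thesis .
  qed (use ell2_off[OF assms] in \<open>simp add: T'_def\<close>)
qed

lemma T_adjoint:
  assumes f: "f \<in> ell2_set Y" and g: "g \<in> ell2_set Y"
  shows "scal (T f) g = scal f (T' g)"
proof -
  let ?C = "\<lambda>x. {y\<in>A. p y = x}"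
  let ?G = "\<lambda>y. w y * f (p y) * cnj (g y)"
  have bij: "bij_betw snd (Sigma Y ?C) A"
    by (rule bij_betw_byWitness[where f' = "\<lambda>y. (p y, y)"]) (auto simp: p_closed)
  have "(\<lambda>y. T f y * cnj (g y)) summable_on UNIV"
    by (rule ell2_product(1)[OF T_closed[OF f] g])
  then have "?G summable_on A"
    by (rule summable_on_cong_neutral[THEN iffD1, rotated -1]) (auto simp: map_shift_def)
  then have s: "(\<lambda>q. ?G (snd q)) summable_on Sigma Y ?C"
    using summable_on_reindex_bij_betw[OF bij, of ?G] by simp
  have "scal (T f) g = infsum ?G A"
    unfolding scal_def by (rule infsum_cong_neutral) (auto simp: map_shift_def)
  also have "\<dots> = infsum (\<lambda>q. ?G (snd q)) (Sigma Y ?C)"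
    using infsum_reindex_bij_betw[OF bij, of ?G] by simp
  also have "\<dots> = (\<Sum>\<^sub>\<infinity>x\<in>Y. \<Sum>\<^sub>\<infinity>y\<in>?C x. ?G y)"
    using infsum_Sigma_banach[OF s] by simp
  also have "\<dots> = (\<Sum>\<^sub>\<infinity>x\<in>Y. f x * cnj (T' g x))"
  proof (rule infsum_cong)
    fix x assume x: "x \<in> Y"
    have "(\<Sum>\<^sub>\<infinity>y\<in>?C x. ?G y) = (\<Sum>\<^sub>\<infinity>y\<in>?C x. f x * cnj (cnj (w y) * g y))"
      by (rule infsum_cong) auto
    also have "\<dots> = f x * cnj (\<Sum>\<^sub>\<infinity>y\<in>?C x. cnj (w y) * g y)"
      by (simp only: infsum_cmult_right' infsum_cnj)
    finally show "(\<Sum>\<^sub>\<infinity>y\<in>?C x. ?G y) = f x * cnj (T' g x)" using x by (simp add: T'_def)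
  qed
  also have "\<dots> = scal f (T' g)"
    unfolding scal_def by (rule infsum_cong_neutral) (auto simp: ell2_off[OF f])
  finally show ?thesis .
qed

text \<open>If \<open>h\<close> is constant along \<open>p\<close>, it acts on each fibre of \<open>p\<close> as the scalar by which it acts at
  the base point of the fibre.\<close>

lemma T_mult:
  assumes "\<And>y. y \<in> A \<Longrightarrow> h (p y) = h y"
  shows "T (\<lambda>x. of_real (h x) * f x) = (\<lambda>x. of_real (h x) * T f x)"
  using assms by (auto simp: map_shift_def)

lemma T'_mult:
  assumes "\<And>y. y \<in> A \<Longrightarrow> h (p y) = h y"
  shows "T' (\<lambda>x. of_real (h x) * f x) = (\<lambda>x. of_real (h x) * T' f x)"
proof
  fix x
  have "(\<Sum>\<^sub>\<infinity>y\<in>{y\<in>A. p y = x}. cnj (w y) * (of_real (h y) * f y)) =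
      (\<Sum>\<^sub>\<infinity>y\<in>{y\<in>A. p y = x}. of_real (h x) * (cnj (w y) * f y))"
    by (rule infsum_cong) (use assms in auto)
  then show "T' (\<lambda>x. of_real (h x) * f x) x = of_real (h x) * T' f x"
    by (simp add: T'_def infsum_cmult_right')
qed

end

section \<open>A normal extension of a shift with invariant multiplier\<close>

lemma scal_add_right:
  assumes "f \<in> ell2_set X" "g \<in> ell2_set X" "h \<in> ell2_set X"
  shows "scal h (\<lambda>v. f v + g v) = scal h f + scal h g"
  using scal_add_left[OF assms]
  by (metis complex_cnj_add scal_commute)

lemma scal_diff_left:
  assumes "f \<in> ell2_set X" "g \<in> ell2_set X" "h \<in> ell2_set X"
  shows "scal (\<lambda>v. f v - g v) h = scal f h - scal g h"
  using scal_add_left[OF assms(1) ell2_uminus[OF assms(2)] assms(3)] scal_smult_left[of "-1" g h]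
  by simp

lemma scal_diff_right:
  assumes "f \<in> ell2_set X" "g \<in> ell2_set X" "h \<in> ell2_set X"
  shows "scal h (\<lambda>v. f v - g v) = scal h f - scal h g"
  using scal_diff_left[OF assms]
  by (metis complex_cnj_diff scal_commute)

context isometric_shift
begin

lemma T'_diff:
  assumes "f \<in> ell2_set Y" "g \<in> ell2_set Y"
  shows "T' (\<lambda>x. f x - g x) = (\<lambda>x. T' f x - T' g x)"
  using T'_add[OF assms(1) ell2_uminus[OF assms(2)]] T'_smult[of "-1" g] by simp

lemma T_adjoint_right:
  assumes "f \<in> ell2_set Y" "g \<in> ell2_set Y"
  shows "scal g (T f) = scal (T' g) f"
  using T_adjoint[OF assms] scal_commute[of g "T f"] scal_commute[of "T' g" f] by simp

end

text \<open>The Halmos dilation: an isometry \<open>T\<close> with adjoint \<open>T'\<close> extends to the unitary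
  \<open>(f, g) \<mapsto> (T f + (1 - T T') g, T' g)\<close> on two copies of the space. The copies are indexed by the
  images of \<open>Y\<close> under two injections into the index type of the larger space.\<close>

locale dilated_shift = isometric_shift Y A p w
  for Y A :: "'y set" and p :: "'y \<Rightarrow> 'y" and w :: "'y \<Rightarrow> complex" +
  fixes h :: "'y \<Rightarrow> real" and a b :: "'y \<Rightarrow> 'x"
  assumes h_invariant: "y \<in> A \<Longrightarrow> h (p y) = h y"
    and inj_a: "inj a" and inj_b: "inj b" and disjoint: "range a \<inter> range b = {}"
begin

text \<open>The pair \<open>(f, g)\<close> as one function on the index type of the larger space.\<close>

definition glue :: "('y \<Rightarrow> 'c::zero) \<Rightarrow> ('y \<Rightarrow> 'c) \<Rightarrow> 'x \<Rightarrow> 'c" where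
  "glue f g = (\<lambda>x. if x \<in> range a then f (inv_into UNIV a x) else if x \<in> range b then g (inv_into UNIV b x) else 0)"

definition X :: "'x set" where "X = a ` Y \<union> b ` Y"

definition U :: "('x \<Rightarrow> complex) \<Rightarrow> 'x \<Rightarrow> complex" where
  "U F = glue (\<lambda>y. T (F \<circ> a) y + (F \<circ> b) y - T (T' (F \<circ> b)) y) (T' (F \<circ> b))"

definition U' :: "('x \<Rightarrow> complex) \<Rightarrow> 'x \<Rightarrow> complex" where
  "U' F = glue (T' (F \<circ> a)) (\<lambda>y. (F \<circ> a) y - T (T' (F \<circ> a)) y + T (F \<circ> b) y)"

lemma b_not_a: "b y \<notin> range a"
  using disjoint by blast

lemma glue_a [simp]: "glue f g (a y) = f y" and glue_b [simp]: "glue f g (b y) = g y"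
  using b_not_a by (auto simp: glue_def inj_a inj_b)

lemma glue_comp [simp]: "glue f g \<circ> a = f" "glue f g \<circ> b = g"
  by auto

lemma glue_off: "x \<notin> range a \<Longrightarrow> x \<notin> range b \<Longrightarrow> glue f g x = 0"
  by (simp add: glue_def)

lemma eq_glueI:
  assumes "\<And>y. F (a y) = f y" "\<And>y. F (b y) = g y" "\<And>x. x \<notin> range a \<Longrightarrow> x \<notin> range b \<Longrightarrow> F x = 0"
  shows "F = glue f g"
proof
  fix x
  consider y where "x = a y" | y where "x = b y" | "x \<notin> range a \<and> x \<notin> range b" by blast
  then show "F x = glue f g x" by cases (auto simp: assms glue_off)
qed

lemma a_in_X: "a y \<in> X \<longleftrightarrow> y \<in> Y" and b_in_X: "b y \<in> X \<longleftrightarrow> y \<in> Y"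
  using disjoint inj_a inj_b by (auto simp: X_def inj_def)

lemma ell2_X_iff:
  "F \<in> ell2_set X \<longleftrightarrow> F \<circ> a \<in> ell2_set Y \<and> F \<circ> b \<in> ell2_set Y \<and>
    (\<forall>x. x \<notin> range a \<longrightarrow> x \<notin> range b \<longrightarrow> F x = 0)" (is "_ \<longleftrightarrow> ?rhs")
proof -
  let ?s = "\<lambda>x. (cmod (F x))\<^sup>2"
  have off: "(\<forall>x. x \<notin> X \<longrightarrow> F x = 0) \<longleftrightarrow> (\<forall>y. y \<notin> Y \<longrightarrow> F (a y) = 0 \<and> F (b y) = 0) \<and>
      (\<forall>x. x \<notin> range a \<longrightarrow> x \<notin> range b \<longrightarrow> F x = 0)" (is "?l \<longleftrightarrow> ?r1 \<and> ?r2")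
  proof
    have "x \<notin> X" if "x \<notin> range a" "x \<notin> range b" for x using that by (auto simp: X_def)
    then show "?r1 \<and> ?r2" if ?l using that by (simp add: a_in_X b_in_X)
    show ?l if r: "?r1 \<and> ?r2"
    proof (intro allI impI)
      fix x assume x: "x \<notin> X"
      consider y where "x = a y" | y where "x = b y" | "x \<notin> range a \<and> x \<notin> range b" by blast
      then show "F x = 0" using r x by cases (auto simp: a_in_X b_in_X)
    qed
  qed
  have "?s summable_on UNIV \<longleftrightarrow> (\<lambda>y. ?s (a y)) summable_on UNIV \<and> (\<lambda>y. ?s (b y)) summable_on UNIV"
    if ?r2
  proof -
    have "?s summable_on UNIV \<longleftrightarrow> ?s summable_on (range a \<union> range b)"
      by (rule summable_on_cong_neutral) (use that in auto)
    also have "\<dots> \<longleftrightarrow> ?s summable_on range a \<and> ?s summable_on range b"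
      using summable_on_Un_disjoint[OF _ _ disjoint, of ?s] summable_on_subset_banach[of ?s "range a \<union> range b"]
      by blast
    finally show ?thesis by (simp add: summable_on_reindex inj_a inj_b o_def)
  qed
  then show ?thesis unfolding ell2_set_alt off by auto
qed

lemma glue_ell2: "f \<in> ell2_set Y \<Longrightarrow> g \<in> ell2_set Y \<Longrightarrow> glue f g \<in> ell2_set X"
  by (simp add: ell2_X_iff glue_off)

lemma ell2_X_components: "F \<in> ell2_set X \<Longrightarrow> F \<circ> a \<in> ell2_set Y \<and> F \<circ> b \<in> ell2_set Y"
  by (simp add: ell2_X_iff)

lemma glue_components: "F \<in> ell2_set X \<Longrightarrow> glue (F \<circ> a) (F \<circ> b) = F"
  by (rule eq_glueI[symmetric]) (auto simp: ell2_X_iff)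

lemma scal_split:
  assumes F: "F \<in> ell2_set X" and G: "G \<in> ell2_set X"
  shows "scal F G = scal (F \<circ> a) (G \<circ> a) + scal (F \<circ> b) (G \<circ> b)"
proof -
  let ?s = "\<lambda>x. F x * cnj (G x)"
  have s: "?s summable_on range a" "?s summable_on range b"
    using ell2_product(1)[OF F G] by (auto intro: summable_on_subset_banach)
  have "scal F G = infsum ?s (range a \<union> range b)"
    unfolding scal_def by (rule infsum_cong_neutral) (use F in \<open>auto simp: ell2_X_iff\<close>)
  also have "\<dots> = infsum ?s (range a) + infsum ?s (range b)"
    by (rule infsum_Un_disjoint[OF s disjoint])
  finally show ?thesis by (simp add: infsum_reindex inj_a inj_b scal_def o_def)
qed

lemma U_closed: "F \<in> ell2_set X \<Longrightarrow> U F \<in> ell2_set X"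
  and U'_closed: "F \<in> ell2_set X \<Longrightarrow> U' F \<in> ell2_set X"
  unfolding U_def U'_def
  by (auto dest!: ell2_X_components intro!: glue_ell2 ell2_add ell2_diff T_closed T'_closed
      simp del: o_apply)

lemma U_adjoint:
  assumes F: "F \<in> ell2_set X" and G: "G \<in> ell2_set X"
  shows "scal (U F) G = scal F (U' G)"
proof -
  define f g f' g' where "f = F \<circ> a" "g = F \<circ> b" "f' = G \<circ> a" "g' = G \<circ> b"
  then have e: "f \<in> ell2_set Y" "g \<in> ell2_set Y" "f' \<in> ell2_set Y" "g' \<in> ell2_set Y"
    using ell2_X_components F G by auto
  note c = e T_closed[OF e(1)] T'_closed[OF e(2)] T'_closed[OF e(3)] T_closed[OF e(4)]
    T_closed[OF T'_closed[OF e(2)]] T_closed[OF T'_closed[OF e(3)]]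
  have "scal (U F) G = scal (\<lambda>y. T f y + g y - T (T' g) y) f' + scal (T' g) g'"
    by (subst scal_split[OF U_closed[OF F] G]) (simp add: U_def f_g_f'_g'_def)
  also have "\<dots> = scal (T f) f' + scal g f' - scal (T (T' g)) f' + scal (T' g) g'"
    by (simp add: scal_diff_left[OF ell2_add(1)[OF c(5,2)] c(9,3)] scal_add_left[OF c(5,2,3)])
  also have "\<dots> = scal f (T' f') + (scal g f' - scal g (T (T' f')) + scal g (T g'))"
    by (simp add: T_adjoint[OF c(1,3)] T_adjoint[OF c(6,3)] T_adjoint_right[OF c(7,2)]
        T_adjoint_right[OF c(4,2)])
  also have "\<dots> = scal f (T' f') + scal g (\<lambda>y. f' y - T (T' f') y + T g' y)"
    by (simp add: scal_add_right[OF ell2_diff[OF c(3,10)] c(8,2)] scal_diff_right[OF c(3,10,2)])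
  also have "\<dots> = scal F (U' G)"
    by (subst scal_split[OF F U'_closed[OF G]]) (simp add: U'_def f_g_f'_g'_def)
  finally show ?thesis .
qed

lemma U'_U:
  assumes F: "F \<in> ell2_set X" shows "U' (U F) = F"
proof -
  define f g where fg: "f = F \<circ> a" "g = F \<circ> b"
  then have e: "f \<in> ell2_set Y" "g \<in> ell2_set Y"
    using ell2_X_components F by auto
  note c = e T_closed[OF e(1)] T'_closed[OF e(2)] T_closed[OF T'_closed[OF e(2)]]
  have "T' (\<lambda>y. T f y + g y - T (T' g) y) = f"
    by (simp add: T'_diff[OF ell2_add(1)[OF c(3,2)] c(5)] T'_add[OF c(3,2)] T'_T c)
  then have "U' (U F) = glue f g"
    unfolding U'_def U_def glue_comp fg[symmetric] by simp
  also have "\<dots> = F" unfolding fg by (rule glue_components[OF F])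
  finally show ?thesis .
qed

lemma U_U':
  assumes F: "F \<in> ell2_set X" shows "U (U' F) = F"
proof -
  define f g where fg: "f = F \<circ> a" "g = F \<circ> b"
  then have e: "f \<in> ell2_set Y" "g \<in> ell2_set Y"
    using ell2_X_components F by auto
  note c = e T'_closed[OF e(1)] T_closed[OF T'_closed[OF e(1)]] T_closed[OF e(2)]
  have "T' (\<lambda>y. f y - T (T' f) y + T g y) = g"
    by (simp add: T'_add[OF ell2_diff[OF c(1,4)] c(5)] T'_diff[OF c(1,4)] T'_T c)
  then have "U (U' F) = glue f g"
    unfolding U'_def U_def glue_comp fg[symmetric] by simp
  also have "\<dots> = F" unfolding fg by (rule glue_components[OF F])
  finally show ?thesis .
qed

lemma U_add:
  assumes "F \<in> ell2_set X" "G \<in> ell2_set X"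
  shows "U (\<lambda>x. F x + G x) = (\<lambda>x. U F x + U G x)"
proof -
  have c: "(\<lambda>x. F x + G x) \<circ> a = (\<lambda>y. (F \<circ> a) y + (G \<circ> a) y)"
    "(\<lambda>x. F x + G x) \<circ> b = (\<lambda>y. (F \<circ> b) y + (G \<circ> b) y)" by auto
  have T'b: "T' (\<lambda>y. (F \<circ> b) y + (G \<circ> b) y) = (\<lambda>y. T' (F \<circ> b) y + T' (G \<circ> b) y)"
    using ell2_X_components[OF assms(1)] ell2_X_components[OF assms(2)] T'_add by blast
  show ?thesis
    unfolding U_def c T'b T_add by (rule eq_glueI[symmetric]) (auto simp: glue_off)
qed

lemma U_smult: "U (\<lambda>x. c * F x) = (\<lambda>x. c * U F x)"
proof -
  have c: "(\<lambda>x. c * F x) \<circ> d = (\<lambda>y. c * (F \<circ> d) y)" for d by auto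
  show ?thesis
    unfolding U_def c T'_smult T_smult
    by (rule eq_glueI[symmetric]) (simp_all add: glue_off algebra_simps del: o_apply)
qed

lemma comp_mult:
  "(\<lambda>x. complex_of_real (glue h h x) * F x) \<circ> a = (\<lambda>y. of_real (h y) * (F \<circ> a) y)"
  "(\<lambda>x. complex_of_real (glue h h x) * F x) \<circ> b = (\<lambda>y. of_real (h y) * (F \<circ> b) y)"
  by auto

lemma h_commutes:
  "T (\<lambda>y. of_real (h y) * f y) = (\<lambda>y. of_real (h y) * T f y)"
  "T' (\<lambda>y. of_real (h y) * f y) = (\<lambda>y. of_real (h y) * T' f y)"
  by (rule T_mult T'_mult, erule h_invariant)+

lemma U_mult: "U (\<lambda>x. of_real (glue h h x) * F x) = (\<lambda>x. of_real (glue h h x) * U F x)"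
  unfolding U_def comp_mult h_commutes
  by (rule eq_glueI[symmetric]) (simp_all add: glue_off algebra_simps del: o_apply)

lemma U'_mult: "U' (\<lambda>x. of_real (glue h h x) * F x) = (\<lambda>x. of_real (glue h h x) * U' F x)"
  unfolding U'_def comp_mult h_commutes
  by (rule eq_glueI[symmetric]) (simp_all add: glue_off algebra_simps del: o_apply)

sublocale commuting_unitary X "glue h h" U U'
  by unfold_locales
    (simp_all only: U_closed U'_closed U_add U_smult U_adjoint U'_U U_U' U_mult U'_mult)

text \<open>The dilation restricts to \<open>T\<close> on the first copy. Since \<open>T\<close> is isometric, square summability
  of \<open>T (h f)\<close> entails that of \<open>h f\<close>, so no domain condition is lost.\<close>

lemma N_extends:
  assumes f: "f \<in> ell2_set Y" and Tf: "T (\<lambda>y. of_real (h y) * f y) \<in> ell2_set Y"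
  shows "N (glue f (\<lambda>_. 0)) = Some (glue (T (\<lambda>y. of_real (h y) * f y)) (\<lambda>_. 0))"
proof -
  let ?hf = "\<lambda>y. of_real (h y) * f y"
  have hf: "?hf \<in> ell2_set Y"
    using Tf nsum_T[of ?hf] ell2_off[OF f] by (simp add: ell2_set_iff_nsum)
  have g: "(\<lambda>x. of_real (glue h h x) * glue f (\<lambda>_. 0) x) = glue ?hf (\<lambda>_. 0)"
    by (rule eq_glueI) (auto simp: glue_off)
  have "T' (\<lambda>_. 0) = (\<lambda>_. 0)" using T'_smult[of 0 "\<lambda>_. 0"] by simp
  moreover have "T (\<lambda>_. 0) = (\<lambda>_. 0)" by (auto simp: map_shift_def)
  ultimately have "U (glue ?hf (\<lambda>_. 0)) = glue (T ?hf) (\<lambda>_. 0)"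
    unfolding U_def glue_comp by simp
  moreover have "glue f (\<lambda>_. 0) \<in> mult_domain X (glue h h)"
    unfolding mult_domain_def using f hf by (simp add: g glue_ell2 ell2_zero)
  ultimately show ?thesis by (simp add: unitary_times_mult_def g)
qed

end

section \<open>Potentials on a directed tree\<close>

context directed_tree
begin

lemma parent_eq: "(u, v) \<in> E \<Longrightarrow> parent E v = u"
  unfolding parent_def using parent_unique by blast

lemma nonroots_iff: "v \<in> nonroots V E \<longleftrightarrow> (parent E v, v) \<in> E"
  using edges parent_eq by (auto simp: nonroots_def roots_def)

lemma parent_in_V: "v \<in> nonroots V E \<Longrightarrow> parent E v \<in> V"
  using edges by (auto simp: nonroots_iff)

lemma children_alt: "children E u = {v \<in> nonroots V E. parent E v = u}"
  using parent_eq by (auto simp: children_def nonroots_iff)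

text \<open>The product of \<open>\<gamma>\<close> over \<open>v\<close> and its first \<open>p - 1\<close> proper ancestors. It has this meaning when
  \<open>v\<close> has at least \<open>p\<close> of them; at a root, \<^term>\<open>parent E v\<close> is unspecified.\<close>

primrec ancestral_prod :: "('v \<Rightarrow> real) \<Rightarrow> nat \<Rightarrow> 'v \<Rightarrow> real" where
  "ancestral_prod \<gamma> 0 v = 1"
| "ancestral_prod \<gamma> (Suc p) v = \<gamma> v * ancestral_prod \<gamma> p (parent E v)"

lemma ancestral_prod_pos: "(\<And>v. \<gamma> v > 0) \<Longrightarrow> ancestral_prod \<gamma> p v > 0"
  by (induction p arbitrary: v) auto

lemma ancestral_prod_add:
  "(x, v) \<in> E ^^ p \<Longrightarrow> ancestral_prod \<gamma> (p + q) v = ancestral_prod \<gamma> p v * ancestral_prod \<gamma> q x"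
proof (induction p arbitrary: v)
  case (Suc p)
  then obtain u where "(x, u) \<in> E ^^ p" "(u, v) \<in> E" by auto
  then show ?case using Suc.IH[of u] parent_eq[of u v] by simp
qed simp

lemma ancestors_chain:
  "(x, v) \<in> E ^^ p \<Longrightarrow> (y, v) \<in> E ^^ (p + d) \<Longrightarrow> (y, x) \<in> E ^^ d"
proof (induction p arbitrary: v)
  case (Suc p)
  then obtain u u' where "(x, u) \<in> E ^^ p" "(u, v) \<in> E" "(y, u') \<in> E ^^ (p + d)" "(u', v) \<in> E"
    by auto
  then show ?case using Suc.IH[of u] parent_unique[of u v u'] by simp
qed simp

text \<open>Two different depths would put the ancestor on a directed circuit.\<close>

lemma ancestor_depth_unique:
  assumes "(x, v) \<in> E ^^ p" "(x, v) \<in> E ^^ q" shows "p = q"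
proof -
  have "p \<ge> q" if "(x, v) \<in> E ^^ p" "(x, v) \<in> E ^^ q" for p q
  proof (rule ccontr)
    assume "\<not> p \<ge> q"
    then obtain d where d: "q = p + Suc d" using less_imp_Suc_add[of p q] by auto
    have "(x, x) \<in> E ^^ Suc d" using ancestors_chain[OF that(1)] that(2) d by blast
    then have "(x, x) \<in> E\<^sup>+" using trancl_power[of "(x, x)" E] by blast
    then show False using no_circuits by (auto simp: acyclic_def)
  qed
  then show ?thesis using assms by (meson le_antisym)
qed

text \<open>Walk along an undirected path from \<open>r\<close> to \<open>v\<close>. An edge walked downwards keeps the common
  ancestor; one walked upwards either shortens the descent to the current vertex or moves the
  ancestor itself one step up.\<close>

lemma common_ancestor:
  assumes "r \<in> V" "v \<in> V"
  shows "\<exists>x p q. (x, v) \<in> E ^^ p \<and> (x, r) \<in> E ^^ q"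
  using connected[OF assms]
proof (induction rule: rtrancl_induct)
  case base
  have "(r, r) \<in> E ^^ 0" by simp
  then show ?case by blast
next
  case (step v w)
  then obtain x p q where x: "(x, v) \<in> E ^^ p" "(x, r) \<in> E ^^ q" by blast
  show ?case
  proof (cases "(v, w) \<in> E")
    case True
    then have "(x, w) \<in> E ^^ Suc p" using x by auto
    then show ?thesis using x by blast
  next
    case False
    then have wv: "(w, v) \<in> E" using step by auto
    show ?thesis
    proof (cases p)
      case 0
      then have "(w, r) \<in> E ^^ Suc q" using x wv relpow_Suc_I2[of w v E r q] by simp
      moreover have "(w, w) \<in> E ^^ 0" by simp
      ultimately show ?thesis by blast
    next
      case (Suc p')
      then obtain u where "(x, u) \<in> E ^^ p'" "(u, v) \<in> E" using x by auto
      then show ?thesis using parent_unique[OF wv] x by blast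
    qed
  qed
qed

text \<open>Moving the common ancestor of \<open>v\<close> and \<open>r\<close> up multiplies numerator and denominator
  by the same product.\<close>

lemma ancestral_ratio_unique:
  assumes pos: "\<And>v. \<gamma> v > 0"
    and x: "(x, v) \<in> E ^^ p" "(x, r) \<in> E ^^ q" and y: "(y, v) \<in> E ^^ p'" "(y, r) \<in> E ^^ q'"
  shows "ancestral_prod \<gamma> p v / ancestral_prod \<gamma> q r = ancestral_prod \<gamma> p' v / ancestral_prod \<gamma> q' r"
proof -
  note nz = ancestral_prod_pos[of \<gamma>, OF pos, THEN less_imp_neq, symmetric]
  \<comment> \<open>By symmetry the ancestor \<open>y\<close> may be taken to lie above \<open>x\<close>.\<close>
  have "ancestral_prod \<gamma> p v / ancestral_prod \<gamma> q r = ancestral_prod \<gamma> p' v / ancestral_prod \<gamma> q' r"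
    if x: "(x, v) \<in> E ^^ p" "(x, r) \<in> E ^^ q" and y: "(y, v) \<in> E ^^ p'" "(y, r) \<in> E ^^ q'"
      and "p \<le> p'" for x y p q p' q'
  proof -
    obtain d where d: "p' = p + d" using \<open>p \<le> p'\<close> le_Suc_ex by blast
    have "(y, x) \<in> E ^^ d" using ancestors_chain[OF x(1)] y(1) d by simp
    then have "(y, r) \<in> E ^^ (q + d)" using x(2) by (auto simp: add.commute[of q] relpow_add)
    then have "q' = q + d" using ancestor_depth_unique[OF y(2)] by simp
    then show ?thesis
      using d ancestral_prod_add[OF x(1), of \<gamma> d] ancestral_prod_add[OF x(2), of \<gamma> d] nz[of d x]
      by simp
  qed
  from this[OF x y] this[OF y x] show ?thesis by (cases "p \<le> p'") auto
qed

text \<open>The potential at \<open>v\<close> is the product of \<open>\<gamma>\<close> on the way down from a common ancestor to \<open>v\<close>,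
  divided by the product on the way down to \<open>r\<close>. Fixing any vertex \<open>r\<close> as reference, instead of a
  root, also covers rootless trees.\<close>

lemma ex_potential:
  fixes \<gamma> :: "'v \<Rightarrow> real"
  assumes pos: "\<And>v. \<gamma> v > 0" and r: "r \<in> V"
  shows "\<exists>c. c r = 1 \<and> (\<forall>v. c v > 0) \<and> (\<forall>u v. (u, v) \<in> E \<longrightarrow> c v = c u * \<gamma> v)"
proof -
  define P where "P v pq \<longleftrightarrow> (\<exists>x. (x, v) \<in> E ^^ fst pq \<and> (x, r) \<in> E ^^ snd pq)" for v pq
  define c where "c v = ancestral_prod \<gamma> (fst (SOME pq. P v pq)) v /
      ancestral_prod \<gamma> (snd (SOME pq. P v pq)) r" for v
  have c_eq: "c v = ancestral_prod \<gamma> p v / ancestral_prod \<gamma> q r"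
    if xp: "(x, v) \<in> E ^^ p" and xq: "(x, r) \<in> E ^^ q" for v x p q
  proof -
    have "P v (p, q)" using that by (auto simp: P_def)
    then have "P v (SOME pq. P v pq)" by (rule someI)
    then show ?thesis unfolding c_def P_def using ancestral_ratio_unique[of \<gamma>, OF pos _ _ xp xq] by blast
  qed
  have "c r = 1" using c_eq[of r r 0 0] by simp
  moreover have "c v > 0" for v by (simp add: c_def ancestral_prod_pos pos)
  moreover have "c v = c u * \<gamma> v" if uv: "(u, v) \<in> E" for u v
  proof -
    have "u \<in> V" using edges uv by auto
    then obtain x p q where x: "(x, u) \<in> E ^^ p" "(x, r) \<in> E ^^ q" using common_ancestor[OF r] by blast
    then have "(x, v) \<in> E ^^ Suc p" using uv by auto
    from c_eq[OF this x(2)] c_eq[OF x] show ?thesis using parent_eq[OF uv] by simp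
  qed
  ultimately show ?thesis by blast
qed

end

section \<open>Masses with finitely many finite moments\<close>

lemma nsum_finite_iff_summable_nat:
  assumes "\<And>k::nat. 0 \<le> C k"
  shows "nsum (\<lambda>k. ennreal (C k)) < \<infinity> \<longleftrightarrow> summable C"
proof -
  have "C summable_on UNIV \<longleftrightarrow> summable C"
    using assms by (simp add: summable_on_UNIV_nonneg_real_iff)
  then show ?thesis using nsum_finite_iff_summable[of C] assms by simp
qed

locale extremal_tree = directed_tree V E for V :: "'v set" and E :: "('v \<times> 'v) set" +
  assumes is_extremal: "extremal V E"
begin

text \<open>The position of \<open>v\<close> in an enumeration of its siblings by all natural numbers.\<close>

definition child_index :: "'v \<Rightarrow> nat" where
  "child_index v = to_nat_on (children E (parent E v)) v"

definition share :: "'v \<Rightarrow> real" where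
  "share v = (1/2) ^ Suc (child_index v)"

text \<open>The factor by which the mass function of \<open>v\<close> exceeds that of its parent at the point \<open>k + 1\<close>. The
  shares of all siblings add up to \<open>1\<close>, which leaves \<open>k\<close> missing from the required total
  \<open>k + 1\<close>. The child with index \<open>k\<close> supplies it, and dividing by its share \<open>2 ^ (- k - 1)\<close> gives the
  excess \<open>k 2 ^ (k + 1)\<close>.\<close>

definition boost :: "'v \<Rightarrow> nat \<Rightarrow> real" where
  "boost v k = (if k = child_index v then 1 + k * 2 ^ Suc k else 1)"

lemma share_pos: "share v > 0"
  by (simp add: share_def)

lemma boost_ge_1: "boost v k \<ge> 1"
  by (simp add: boost_def)

lemma boost_bounded: "\<exists>B. \<forall>k. boost v k \<le> B"
  by (rule exI[of _ "1 + real (child_index v) * 2 ^ Suc (child_index v)"]) (auto simp: boost_def)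

lemma nsum_children:
  assumes u: "u \<in> V"
  shows "nsum (\<lambda>v. if v \<in> nonroots V E \<and> parent E v = u then ennreal (share v * boost v k) else 0) =
    ennreal (Suc k)"
proof -
  let ?C = "children E u"
  let ?F = "\<lambda>j. ennreal ((1/2) ^ Suc j) + (if j = k then ennreal k else 0)"
  have bij: "bij_betw (to_nat_on ?C) ?C UNIV"
    using is_extremal u by (intro to_nat_on_infinite) (auto simp: extremal_def)
  have "nsum (\<lambda>v. if v \<in> nonroots V E \<and> parent E v = u then ennreal (share v * boost v k) else 0) =
      nsum (\<lambda>v. ?F (to_nat_on ?C v) * indicator ?C v)"
  proof (rule nn_integral_cong)
    fix v
    show "(if v \<in> nonroots V E \<and> parent E v = u then ennreal (share v * boost v k) else 0) =
        ?F (to_nat_on ?C v) * indicator ?C v"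
    proof (cases "v \<in> ?C")
      case True
      then have v: "v \<in> nonroots V E" "parent E v = u" by (auto simp: children_alt)
      have "share v * boost v k = (1/2) ^ Suc j + (if j = k then k else 0)"
        if "j = to_nat_on ?C v" for j
        using that by (simp add: share_def boost_def child_index_def v(2) distrib_left power_divide add_divide_distrib)
      then show ?thesis using v True by (simp add: ennreal_plus)
    qed (auto simp: children_alt)
  qed
  also have "\<dots> = (\<integral>\<^sup>+v. ?F (to_nat_on ?C v) \<partial>count_space ?C)"
    by (simp add: nn_integral_count_space_indicator)
  also have "\<dots> = nsum ?F"
    by (rule nn_integral_bij_count_space[OF bij])
  also have "\<dots> = nsum (\<lambda>j. ennreal ((1/2) ^ Suc j)) + nsum (\<lambda>j. if j = k then ennreal k else 0)"
    by (rule nn_integral_add) auto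
  also have "nsum (\<lambda>j. ennreal ((1/2) ^ Suc j)) = 1"
    using power_half_series unfolding nn_integral_count_space_nat
    by (subst suminf_ennreal2) (auto simp: sums_iff)
  also have "nsum (\<lambda>j. if j = k then ennreal k else 0) = ennreal k"
    by (subst nsum_single[of k]) auto
  finally show ?thesis by (simp flip: ennreal_1 ennreal_plus add: add.commute)
qed

text \<open>At the base vertex the mass at \<open>t\<close> is \<open>1 / t ^ (n + 2)\<close>, whose moments up to order \<open>n\<close> converge
  and whose next moment is the harmonic series. One edge changes the mass function by a
  bounded factor not below \<open>1\<close>, so along the undirected path from the base vertex all mass
  functions stay comparable to this one.\<close>

lemma ex_masses:
  "\<exists>m. (\<forall>v k. m v k > (0::real)) \<and>
    (\<forall>v\<in>nonroots V E. \<forall>k. m v k = m (parent E v) k * boost v k) \<and>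
    (\<forall>v\<in>V. \<forall>i\<le>n. nsum (\<lambda>k. ennreal (m v k * real (Suc k) ^ i)) < \<infinity>) \<and>
    (\<forall>v\<in>V. nsum (\<lambda>k. ennreal (m v k * real (Suc k) ^ Suc n)) = \<infinity>)"
proof -
  obtain r where r: "r \<in> V" using nonempty by blast
  have "\<exists>c. c r = 1 \<and> (\<forall>v. c v > 0) \<and> (\<forall>u v. (u, v) \<in> E \<longrightarrow> c v = c u * boost v k)" for k
    using boost_ge_1[of _ k] r by (intro ex_potential) (auto intro: less_le_trans[of 0 1])
  then obtain c where c: "c k r = 1" "c k v > 0" "(u, v) \<in> E \<Longrightarrow> c k v = c k u * boost v k" for k u v
    by metis
  define m where "m v k = c k v / real (Suc k) ^ (n + 2)" for v k
  have bounds: "\<exists>A B. A > 0 \<and> (\<forall>k. A \<le> c k v \<and> c k v \<le> B)" if "v \<in> V" for v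
    using connected[OF r that]
  proof (induction rule: rtrancl_induct)
    case base
    show ?case by (rule exI[of _ 1], rule exI[of _ 1]) (simp add: c)
  next
    case (step v w)
    then obtain A B where AB: "A > 0" "\<And>k. A \<le> c k v" "\<And>k. c k v \<le> B" by blast
    then have B: "B > 0" by (meson less_le_trans)
    show ?case
    proof (cases "(v, w) \<in> E")
      case True
      obtain D where D: "\<And>k. boost w k \<le> D" using boost_bounded by blast
      have "A \<le> c k w \<and> c k w \<le> B * D" for k
      proof
        have "A * 1 \<le> c k v * boost w k"
          using AB(1,2) boost_ge_1[of w k] c(2)[of k v] by (intro mult_mono) auto
        then show "A \<le> c k w" by (simp add: c(3)[OF True])
        have "c k v * boost w k \<le> B * D"
          using AB(3) D[of k] B boost_ge_1[of w k] by (intro mult_mono) auto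
        then show "c k w \<le> B * D" by (simp add: c(3)[OF True])
      qed
      then show ?thesis using AB(1) by blast
    next
      case False
      then have wv: "(w, v) \<in> E" using step by auto
      obtain D where D: "\<And>k. boost v k \<le> D" using boost_bounded by blast
      then have D0: "D > 0" using boost_ge_1[of v 0] by (meson less_le_trans zero_less_one)
      have "A / D \<le> c k w \<and> c k w \<le> B" for k
      proof
        have "A \<le> c k w * boost v k" using AB(2)[of k] by (simp add: c(3)[OF wv])
        also have "\<dots> \<le> c k w * D" using D[of k] c(2)[of k w] by (intro mult_left_mono) auto
        finally show "A / D \<le> c k w" using D0 by (simp add: divide_le_eq)
        have "c k w * 1 \<le> c k w * boost v k" using boost_ge_1[of v k] c(2)[of k w] by (intro mult_left_mono) auto
        then show "c k w \<le> B" using AB(3)[of k] by (simp add: c(3)[OF wv])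
      qed
      then show ?thesis using AB(1) D0 by (meson divide_pos_pos)
    qed
  qed
  have m_pos: "m v k > 0" for v k unfolding m_def by (intro divide_pos_pos zero_less_power c(2)) simp
  moreover have "m v k = m (parent E v) k * boost v k" if "v \<in> nonroots V E" for v k
    using that c(3) by (simp add: m_def nonroots_iff)
  moreover have "nsum (\<lambda>k. ennreal (m v k * real (Suc k) ^ i)) < \<infinity>" if v: "v \<in> V" and i: "i \<le> n" for v i
  proof -
    obtain B where B: "\<And>k. c k v \<le> B" using bounds[OF v] by blast
    have "summable (\<lambda>k. B * (1 / real (Suc k) ^ 2))"
      using inverse_power_summable[of 2, where 'a=real] summable_Suc_iff[of "\<lambda>k. 1 / real k ^ 2"]
      by (intro summable_mult) (simp add: inverse_eq_divide power_one_over del: of_nat_Suc)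
    then have "summable (\<lambda>k. m v k * real (Suc k) ^ i)"
    proof (rule summable_comparison_test'[of _ 0])
      fix k :: nat
      have "real (Suc k) ^ i \<le> real (Suc k) ^ n" using i by (intro power_increasing) auto
      then have "c k v * real (Suc k) ^ i / (real (Suc k) ^ n * real (Suc k) ^ 2) \<le>
          B * real (Suc k) ^ n / (real (Suc k) ^ n * real (Suc k) ^ 2)"
        using B[of k] c(2)[of k v] by (intro divide_right_mono mult_mono) auto
      then show "norm (m v k * real (Suc k) ^ i) \<le> B * (1 / real (Suc k) ^ 2)"
        using c(2)[of k v] by (simp add: m_def power_add power2_eq_square abs_mult mult_ac del: of_nat_Suc)
    qed
    then show ?thesis using m_pos nsum_finite_iff_summable_nat[of "\<lambda>k. m v k * real (Suc k) ^ i"] less_imp_le[OF m_pos[of v]] by simp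
  qed
  moreover have "nsum (\<lambda>k. ennreal (m v k * real (Suc k) ^ Suc n)) = \<infinity>" if v: "v \<in> V" for v
  proof (rule ccontr)
    assume "nsum (\<lambda>k. ennreal (m v k * real (Suc k) ^ Suc n)) \<noteq> \<infinity>"
    then have s: "summable (\<lambda>k. m v k * real (Suc k) ^ Suc n)"
      using nsum_finite_iff_summable_nat[of "\<lambda>k. m v k * real (Suc k) ^ Suc n"] less_imp_le[OF m_pos[of v]]
      by (simp add: less_top)
    obtain A where A: "A > 0" "\<And>k. A \<le> c k v" using bounds[OF v] by blast
    have "summable (\<lambda>k. A * (1 / real (Suc k)))"
    proof (rule summable_comparison_test'[OF s, of 0])
      fix k :: nat
      have "m v k * real (Suc k) ^ Suc n = c k v / Suc k"
        by (simp add: m_def power_add power2_eq_square del: of_nat_Suc)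
      moreover have "A / Suc k \<le> c k v / Suc k" using A(2) by (intro divide_right_mono) auto
      ultimately show "norm (A * (1 / real (Suc k))) \<le> m v k * real (Suc k) ^ Suc n"
        using A(1) by simp
    qed
    then have "summable (\<lambda>k. 1 / real (Suc k))" 
      using A(1) by (subst (asm) summable_cmult_iff) auto
    then show False using not_summable_harmonic[where 'a=real]
        summable_Suc_iff[of "\<lambda>k. 1 / real k"] by (simp add: inverse_eq_divide)
  qed
  ultimately show ?thesis by blast
qed

end

section \<open>The weights and the powers of the shift\<close>

locale shift_masses = extremal_tree V E for V :: "'v set" and E :: "('v \<times> 'v) set" +
  fixes n :: nat and m :: "'v \<Rightarrow> nat \<Rightarrow> real"
  assumes m_pos: "m v k > 0"
    and m_step: "v \<in> nonroots V E \<Longrightarrow> m v k = m (parent E v) k * boost v k"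
    and finite_moment: "v \<in> V \<Longrightarrow> i \<le> n \<Longrightarrow> nsum (\<lambda>k. ennreal (m v k * real (Suc k) ^ i)) < \<infinity>"
    and infinite_moment: "v \<in> V \<Longrightarrow> nsum (\<lambda>k. ennreal (m v k * real (Suc k) ^ Suc n)) = \<infinity>"
begin

definition total_mass :: "'v \<Rightarrow> real" where
  "total_mass v = enn2real (nsum (\<lambda>k. ennreal (m v k)))"

text \<open>The factors \<open>total_mass\<close> pass from the masses to the normalised ones, as the spread
  unit vectors must have norm one.\<close>

definition weight :: "'v \<Rightarrow> complex" where
  "weight v = of_real (sqrt (share v * total_mass v / total_mass (parent E v)))"

definition moment :: "nat \<Rightarrow> 'v \<Rightarrow> ennreal" where
  "moment i v = nsum (\<lambda>k. ennreal (m v k * real (Suc k) ^ i / total_mass v))"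

abbreviation "L \<equiv> shift_map V E weight"
abbreviation "S \<equiv> weighted_shift V E weight"

lemma L_eq_map_shift: "L = map_shift (nonroots V E) (parent E) weight"
  by (auto simp: shift_map_def map_shift_def)

lemma ennreal_total:
  assumes "v \<in> V" shows "ennreal (total_mass v) = nsum (\<lambda>k. ennreal (m v k))"
  unfolding total_mass_def using finite_moment[OF assms, of 0] by (simp add: less_top)

lemma total_pos:
  assumes "v \<in> V" shows "total_mass v > 0"
proof -
  have "nsum (\<lambda>k. ennreal (m v k)) \<ge> nsum (\<lambda>k. ennreal (m v k) * indicator {0} k)"
    by (rule nn_integral_mono) (auto simp: indicator_def)
  also have "nsum (\<lambda>k. ennreal (m v k) * indicator {0} k) = ennreal (m v 0)"
    by (subst nsum_single[of 0]) auto
  finally have "ennreal (m v 0) \<le> ennreal (total_mass v)" by (simp add: ennreal_total[OF assms])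
  then show ?thesis using m_pos[of v 0]
    by (metis ennreal_le_iff2 less_le_trans not_less)
qed

lemma nonroot_total_pos: "v \<in> nonroots V E \<Longrightarrow> total_mass v > 0 \<and> total_mass (parent E v) > 0"
  using total_pos parent_in_V by (auto simp: nonroots_def)

lemma weight_nonzero: "v \<in> nonroots V E \<Longrightarrow> weight v \<noteq> 0"
  using nonroot_total_pos[of v] share_pos[of v] by (auto simp: weight_def)

lemma moment_eq:
  assumes "v \<in> V"
  shows "moment i v = nsum (\<lambda>k. ennreal (m v k * real (Suc k) ^ i)) * ennreal (1 / total_mass v)"
proof -
  have "ennreal (m v k * real (Suc k) ^ i / total_mass v) =
      ennreal (m v k * real (Suc k) ^ i) * ennreal (1 / total_mass v)" for k
    using total_pos[OF assms] m_pos[of v k] by (subst ennreal_mult[symmetric]) auto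
  then show ?thesis
    unfolding moment_def by (simp only: nn_integral_multc borel_measurable_count_space)
qed

lemma moment_0:
  assumes "v \<in> V" shows "moment 0 v = 1"
  using total_pos[OF assms]
  by (simp add: moment_eq[OF assms] ennreal_total[OF assms, symmetric] ennreal_mult'[symmetric])

lemma moment_finite: "v \<in> V \<Longrightarrow> i \<le> n \<Longrightarrow> moment i v < \<infinity>"
  using finite_moment[of v i] by (simp add: moment_eq ennreal_mult_less_top)

lemma moment_infinite: "v \<in> V \<Longrightarrow> moment (Suc n) v = \<infinity>"
  using total_pos[of v] unfolding moment_eq infinite_moment
  by (simp add: ennreal_top_mult ennreal_eq_0_iff not_le)

text \<open>Interchanging the sums over the children and over the points reduces this to the splitting of
  \<open>t\<close> times the mass function of \<open>u\<close> among the children.\<close>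

lemma moment_Suc:
  assumes u: "u \<in> V"
  shows "nsum (\<lambda>v. if v \<in> nonroots V E \<and> parent E v = u
      then ennreal ((cmod (weight v))\<^sup>2) * moment i v else 0) = moment (Suc i) u"
proof -
  let ?A = "\<lambda>v. v \<in> nonroots V E \<and> parent E v = u"
  let ?a = "\<lambda>k. ennreal (m u k * real (Suc k) ^ i / total_mass u)"
  have step: "(if ?A v then ennreal ((cmod (weight v))\<^sup>2) * moment i v else 0) =
      nsum (\<lambda>k. ?a k * (if ?A v then ennreal (share v * boost v k) else 0))" for v
  proof (cases "?A v")
    case True
    then have v: "total_mass v > 0" "total_mass u > 0" using nonroot_total_pos[of v] by auto
    have w: "(cmod (weight v))\<^sup>2 = share v * total_mass v / total_mass u"
      using True v share_pos[of v] by (simp add: weight_def)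
    have "ennreal ((cmod (weight v))\<^sup>2) * ennreal (m v k * real (Suc k) ^ i / total_mass v) =
        ?a k * ennreal (share v * boost v k)" for k
    proof -
      have "m v k = m u k * boost v k" using True m_step by auto
      then have "(cmod (weight v))\<^sup>2 * (m v k * real (Suc k) ^ i / total_mass v) =
          (m u k * real (Suc k) ^ i / total_mass u) * (share v * boost v k)"
        using v by (simp add: w field_simps del: of_nat_Suc)
      moreover have "0 \<le> m v k * real (Suc k) ^ i / total_mass v" "0 \<le> share v * boost v k"
        using v m_pos[of v k] share_pos[of v] boost_ge_1[of v k] by auto
      ultimately show ?thesis by (simp only: ennreal_mult''[symmetric])
    qed
    then have "ennreal ((cmod (weight v))\<^sup>2) * moment i v =
        nsum (\<lambda>k. ?a k * ennreal (share v * boost v k))"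
      unfolding moment_def by (subst nn_integral_cmult[symmetric]) simp_all
    then show ?thesis using True by simp
  qed auto
  have "nsum (\<lambda>v. nsum (\<lambda>k. ?a k * (if ?A v then ennreal (share v * boost v k) else 0))) =
      nsum (\<lambda>k. nsum (\<lambda>v. ?a k * (if ?A v then ennreal (share v * boost v k) else 0)))"
    by (rule nsum_swap)
  also have "\<dots> = nsum (\<lambda>k. ?a k * ennreal (Suc k))"
    by (subst nn_integral_cmult) (simp_all only: nsum_children[OF u] borel_measurable_count_space)
  also have "\<dots> = moment (Suc i) u"
    unfolding moment_def
    by (rule nn_integral_cong)
      (simp only: ennreal_mult''[symmetric] of_nat_0_le_iff, simp add: mult_ac del: of_nat_Suc)
  finally show ?thesis by (simp only: step)
qed

lemma L_off: "(\<And>v. v \<notin> V \<Longrightarrow> f v = 0) \<Longrightarrow> v \<notin> V \<Longrightarrow> (L ^^ i) f v = 0"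
  by (cases i) (auto simp: shift_map_def nonroots_def)

text \<open>The \<open>j\<close>-th moments weigh the sum so that one application of \<open>L\<close> raises the order by one; the
  case \<open>j = 0\<close> gives norms, since the normalised masses have total one.\<close>

lemma nsum_L_power:
  assumes f: "\<And>v. v \<notin> V \<Longrightarrow> f v = 0"
  shows "nsum (\<lambda>v. ennreal ((cmod ((L ^^ i) f v))\<^sup>2) * moment j v) =
    nsum (\<lambda>v. ennreal ((cmod (f v))\<^sup>2) * moment (i + j) v)"
proof (induction i arbitrary: j)
  case (Suc i)
  have "nsum (\<lambda>v. ennreal ((cmod ((L ^^ Suc i) f v))\<^sup>2) * moment j v) =
      nsum (\<lambda>v. ennreal ((cmod ((L ^^ i) f v))\<^sup>2) * moment (Suc j) v)"
    unfolding funpow.simps o_apply L_eq_map_shift nsum_map_shift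
  proof (rule nn_integral_cong)
    fix u
    let ?F = "(map_shift (nonroots V E) (parent E) weight ^^ i) f"
    show "ennreal ((cmod (?F u))\<^sup>2) * nsum (\<lambda>v. if v \<in> nonroots V E \<and> parent E v = u
          then ennreal ((cmod (weight v))\<^sup>2) * moment j v else 0) =
        ennreal ((cmod (?F u))\<^sup>2) * moment (Suc j) u"
      using moment_Suc[of u j] L_off[of f u i, OF f] by (cases "u \<in> V") (auto simp: L_eq_map_shift)
  qed
  then show ?case using Suc.IH[of "Suc j"] by simp
qed simp

lemma L_power_ell2_iff:
  assumes f: "\<And>v. v \<notin> V \<Longrightarrow> f v = 0"
  shows "(L ^^ i) f \<in> ell2_set V \<longleftrightarrow> nsum (\<lambda>v. ennreal ((cmod (f v))\<^sup>2) * moment i v) < \<infinity>"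
proof -
  have "nsum (\<lambda>v. ennreal ((cmod ((L ^^ i) f v))\<^sup>2)) = nsum (\<lambda>v. ennreal ((cmod ((L ^^ i) f v))\<^sup>2) * moment 0 v)"
  proof (rule nn_integral_cong)
    show "ennreal ((cmod ((L ^^ i) f v))\<^sup>2) = ennreal ((cmod ((L ^^ i) f v))\<^sup>2) * moment 0 v" for v
      using L_off[of f v i, OF f] by (cases "v \<in> V") (auto simp: moment_0)
  qed
  then show ?thesis
    unfolding ell2_set_iff_nsum using L_off[of f _ i, OF f] nsum_L_power[of f i 0, OF f] by simp
qed

lemma op_power_S:
  "op_power (ell2 V) S k = (\<lambda>f. if \<forall>i\<le>k. (L ^^ i) f \<in> ell2_set V then Some ((L ^^ k) f) else None)"
proof (induction k)
  case (Suc k)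
  show ?case
  proof
    fix f
    show "op_power (ell2 V) S (Suc k) f =
        (if \<forall>i\<le>Suc k. (L ^^ i) f \<in> ell2_set V then Some ((L ^^ Suc k) f) else None)"
      using Suc.IH by (auto simp: map_comp_def weighted_shift_def le_Suc_eq)
  qed
qed (auto simp: fun_eq_iff)

lemma dom_op_power_S: "dom (op_power (ell2 V) S k) = {f. \<forall>i\<le>k. (L ^^ i) f \<in> ell2_set V}"
  by (auto simp: op_power_S split: if_splits)

lemma finite_support_in_dom:
  assumes "k \<le> n" and fin: "finite {v. f v \<noteq> 0}" and f: "\<And>v. v \<notin> V \<Longrightarrow> f v = 0"
  shows "f \<in> dom (op_power (ell2 V) S k)"
proof -
  have "(L ^^ i) f \<in> ell2_set V" if "i \<le> k" for i
  proof -
    have "nsum (\<lambda>v. ennreal ((cmod (f v))\<^sup>2) * moment i v) =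
        (\<Sum>v\<in>{v. f v \<noteq> 0}. ennreal ((cmod (f v))\<^sup>2) * moment i v)"
      by (rule nn_integral_count_space'[OF fin]) auto
    also have "\<dots> < \<infinity>"
    proof -
      have "moment i v < \<infinity>" if "f v \<noteq> 0" for v
        using f that \<open>i \<le> k\<close> \<open>k \<le> n\<close> by (intro moment_finite) auto
      then show ?thesis using fin by (auto simp: ennreal_mult_less_top)
    qed
    finally show ?thesis by (simp add: L_power_ell2_iff f)
  qed
  then show ?thesis by (simp add: dom_op_power_S)
qed

lemma densely_defined_S_power:
  assumes "k \<le> n" shows "densely_defined (ell2 V) (op_power (ell2 V) S k)"
  unfolding densely_defined_def
proof (rule finite_support_dense)
  show "dom (op_power (ell2 V) S k) \<subseteq> ell2_set V"
    unfolding dom_op_power_S by (auto dest: spec[of _ 0])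
qed (rule finite_support_in_dom[OF assms])

lemma dom_S_power_Suc_n: "dom (op_power (ell2 V) S (Suc n)) = {\<zero>\<^bsub>ell2 V\<^esub>}"
proof
  show "dom (op_power (ell2 V) S (Suc n)) \<subseteq> {\<zero>\<^bsub>ell2 V\<^esub>}"
  proof
    fix f assume f: "f \<in> dom (op_power (ell2 V) S (Suc n))"
    then have "(L ^^ 0) f \<in> ell2_set V" and L: "(L ^^ Suc n) f \<in> ell2_set V"
      unfolding dom_op_power_S by blast+
    then have off: "f v = 0" if "v \<notin> V" for v using that by (simp add: ell2_off)
    have fin: "nsum (\<lambda>v. ennreal ((cmod (f v))\<^sup>2) * moment (Suc n) v) < \<infinity>"
      using L L_power_ell2_iff[of f "Suc n", OF off] by blast
    have "f u = 0" for u
    proof (rule ccontr)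
      assume u: "f u \<noteq> 0"
      then have "u \<in> V" using off by blast
      let ?F = "\<lambda>v. ennreal ((cmod (f v))\<^sup>2) * moment (Suc n) v"
      have "?F u = nsum (\<lambda>v. ?F v * indicator {u} v)"
        by (subst nsum_single[of u]) auto
      also have "\<dots> \<le> nsum ?F" by (rule nn_integral_mono) (auto simp: indicator_def)
      finally show False
        using fin u moment_infinite[OF \<open>u \<in> V\<close>] by (auto simp: ennreal_mult_top top_unique)
    qed
    then show "f \<in> {\<zero>\<^bsub>ell2 V\<^esub>}" by (auto simp: ell2_def)
  qed
  have z: "(L ^^ i) (\<lambda>v. 0) = (\<lambda>v. 0)" for i
    by (induction i) (auto simp: shift_map_def)
  show "{\<zero>\<^bsub>ell2 V\<^esub>} \<subseteq> dom (op_power (ell2 V) S (Suc n))"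
    unfolding dom_op_power_S using z by (simp add: ell2_def ell2_zero)
qed

lemma dom_S: "dom S = {f \<in> ell2_set V. L f \<in> ell2_set V}"
  by (auto simp: weighted_shift_def split: if_splits)

lemma the_S: "f \<in> dom S \<Longrightarrow> the (S f) = L f"
  by (auto simp: weighted_shift_def split: if_splits)

lemma densely_defined_S:
  assumes "n > 0" shows "densely_defined (ell2 V) S"
proof -
  have "dom (op_power (ell2 V) S 1) = dom S"
    unfolding dom_op_power_S dom_S by (auto simp: le_Suc_eq)
  then show ?thesis using densely_defined_S_power[of 1] assms by (simp add: densely_defined_def)
qed

lemma linear_operator_S: "linear_operator (ell2 V) S"
proof -
  interpret M: Module.module complex_ring "ell2 V" by (rule module_ell2)
  have add: "f \<oplus>\<^bsub>ell2 V\<^esub> g = (\<lambda>x. f x + g x)" and smult: "c \<odot>\<^bsub>ell2 V\<^esub> f = (\<lambda>x. c * f x)"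
    and zero: "\<zero>\<^bsub>ell2 V\<^esub> = (\<lambda>x. 0)" for f g c
    by (auto simp: ell2_def)
  have L_add: "L (\<lambda>x. f x + g x) = (\<lambda>x. L f x + L g x)"
    and L_smult: "L (\<lambda>x. c * f x) = (\<lambda>x. c * L f x)" for f g c
    by (auto simp: shift_map_def algebra_simps)
  have dom_smult: "(\<lambda>x. c * f x) \<in> dom S" if "f \<in> dom S" for c f
    using that by (simp add: dom_S L_smult ell2_smult)
  have dom_add: "(\<lambda>x. f x + g x) \<in> dom S" if "f \<in> dom S" "g \<in> dom S" for f g
    using that by (simp add: dom_S L_add ell2_add)
  have "submodule (dom S) complex_ring (ell2 V)"
  proof (rule M.submoduleI)
    show "dom S \<subseteq> carrier (ell2 V)" by (auto simp: dom_S)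
    have "L (\<lambda>v. 0) = (\<lambda>v. 0)" by (auto simp: shift_map_def)
    then show "\<zero>\<^bsub>ell2 V\<^esub> \<in> dom S" by (simp add: zero dom_S ell2_zero)
    fix f assume f: "f \<in> dom S"
    have "\<ominus>\<^bsub>ell2 V\<^esub> f = (\<lambda>x. (-1) * f x)"
      by (rule M.minus_equality) (use f in \<open>auto simp: add zero dom_S ell2_uminus\<close>)
    then show "\<ominus>\<^bsub>ell2 V\<^esub> f \<in> dom S" using dom_smult[OF f, of "-1"] by simp
  qed (simp_all add: add smult dom_add dom_smult)
  moreover have "ran S \<subseteq> carrier (ell2 V)"
    by (auto simp: ran_def weighted_shift_def split: if_splits)
  ultimately show ?thesis
    unfolding linear_operator_def add smult by (simp add: the_S dom_add dom_smult L_add L_smult)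
qed

section \<open>Subnormality\<close>

text \<open>For fixed \<open>k\<close> the squares of these weights add up to one over the children of each vertex,
  because \<^term>\<open>share v * boost v k\<close> adds up to \<open>k + 1\<close>.\<close>

definition fibre_weight :: "'v \<times> nat \<Rightarrow> complex" where
  "fibre_weight y = of_real (sqrt (share (fst y) * boost (fst y) (snd y) / real (Suc (snd y))))"

text \<open>Two copies of the set of pairs \<open>(v, k)\<close> among the complex functions: multiples of the unit vector
  of \<open>v\<close> by \<open>k + 1\<close> and by its negative. With \<open>k + 1\<close> in place of \<open>k\<close> these multiples are nonzero, so
  that \<open>v\<close> can be recovered.\<close>

definition plus_index :: "'v \<times> nat \<Rightarrow> 'v \<Rightarrow> complex" where
  "plus_index y = (\<lambda>x. if x = fst y then of_nat (Suc (snd y)) else 0)"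

definition minus_index :: "'v \<times> nat \<Rightarrow> 'v \<Rightarrow> complex" where
  "minus_index y = (\<lambda>x. if x = fst y then - of_nat (Suc (snd y)) else 0)"

text \<open>Evaluation at the first component of a pair tells whether it carries the nonzero value.\<close>

lemma index_injective:
  "inj plus_index" "inj minus_index" "range plus_index \<inter> range minus_index = {}"
proof -
  have nz: "of_nat (Suc k) \<noteq> (0::complex)" and eq: "of_nat (Suc k) = (of_nat (Suc k') :: complex) \<longleftrightarrow> k = k'"
    for k k' by (simp_all only: of_nat_eq_0_iff of_nat_eq_iff) simp_all
  have "Re (of_nat (Suc k)) \<noteq> Re (- of_nat (Suc k') :: complex)" for k k' by simp
  then have sign: "of_nat (Suc k) \<noteq> (- of_nat (Suc k') :: complex)" for k k' by metis
  show "inj plus_index"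
  proof (rule injI)
    fix y z assume "plus_index y = plus_index z"
    from fun_cong[OF this, of "fst y"] show "y = z"
      unfolding plus_index_def minus_index_def using nz eq by (auto split: if_splits simp: prod_eq_iff simp del: of_nat_Suc)
  qed
  show "inj minus_index"
  proof (rule injI)
    fix y z assume "minus_index y = minus_index z"
    from fun_cong[OF this, of "fst y"] show "y = z"
      unfolding plus_index_def minus_index_def using nz eq by (auto split: if_splits simp: prod_eq_iff simp del: of_nat_Suc)
  qed
  have "plus_index y \<noteq> minus_index z" for y z
  proof
    assume "plus_index y = minus_index z"
    from fun_cong[OF this, of "fst y"] show False
      unfolding plus_index_def minus_index_def using nz sign by (auto split: if_splits simp del: of_nat_Suc)
  qed
  then show "range plus_index \<inter> range minus_index = {}" by blast
qed

lemma nsum_pair: "nsum (\<lambda>y. F (fst y) (snd y)) = nsum (\<lambda>v. nsum (\<lambda>k. F v k))"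
  using nn_integral_fst_count_space[of "\<lambda>y. F (fst y) (snd y)"] by simp

sublocale dilation: dilated_shift "V \<times> UNIV" "nonroots V E \<times> UNIV" "\<lambda>y. (parent E (fst y), snd y)"
  fibre_weight "\<lambda>y. sqrt (Suc (snd y))" plus_index minus_index
proof unfold_locales
  fix x :: "'v \<times> nat" assume x: "x \<in> V \<times> UNIV"
  obtain u k where uk: "x = (u, k)" by fastforce
  let ?A = "\<lambda>v. v \<in> nonroots V E \<and> parent E v = u"
  have "nsum (\<lambda>y. if y \<in> nonroots V E \<times> UNIV \<and> (parent E (fst y), snd y) = x
        then ennreal ((cmod (fibre_weight y))\<^sup>2) else 0) =
      nsum (\<lambda>y. if ?A (fst y) \<and> snd y = k
        then ennreal ((cmod (fibre_weight (fst y, snd y)))\<^sup>2) else 0)"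
    by (rule nn_integral_cong) (auto simp: uk)
  also have "\<dots> = nsum (\<lambda>v. nsum (\<lambda>j. if ?A v \<and> j = k
        then ennreal ((cmod (fibre_weight (v, j)))\<^sup>2) else 0))"
    by (rule nsum_pair[of "\<lambda>v j. if ?A v \<and> j = k then ennreal ((cmod (fibre_weight (v, j)))\<^sup>2) else 0"])
  also have "\<dots> = nsum (\<lambda>v. (if ?A v then ennreal (share v * boost v k) else 0) * ennreal (1 / Suc k))"
  proof (rule nn_integral_cong)
    fix v
    have "ennreal ((cmod (fibre_weight (v, k)))\<^sup>2) =
        ennreal (share v * boost v k) * ennreal (1 / Suc k)"
      using share_pos[of v] boost_ge_1[of v k]
      by (subst ennreal_mult''[symmetric]) (simp_all add: fibre_weight_def)
    moreover have "nsum (\<lambda>j. if ?A v \<and> j = k then ennreal ((cmod (fibre_weight (v, j)))\<^sup>2) else 0) =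
        (if ?A v then ennreal ((cmod (fibre_weight (v, k)))\<^sup>2) else 0)"
      by (subst nsum_single[of k]) auto
    ultimately show "nsum (\<lambda>j. if ?A v \<and> j = k then ennreal ((cmod (fibre_weight (v, j)))\<^sup>2) else 0) =
        (if ?A v then ennreal (share v * boost v k) else 0) * ennreal (1 / Suc k)"
      by (simp del: of_nat_Suc)
  qed
  also have "\<dots> = ennreal (Suc k) * ennreal (1 / Suc k)"
    using x by (subst nn_integral_multc) (simp_all add: nsum_children uk del: of_nat_Suc)
  also have "\<dots> = 1"
    by (simp add: ennreal_mult''[symmetric] del: of_nat_Suc)
  finally show "nsum (\<lambda>y. if y \<in> nonroots V E \<times> UNIV \<and> (parent E (fst y), snd y) = x
        then ennreal ((cmod (fibre_weight y))\<^sup>2) else 0) = 1" .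
qed (use parent_in_V index_injective in \<open>auto simp: nonroots_def\<close>)

text \<open>The unit vector of \<open>v\<close> becomes the family of square roots of its normalised masses.\<close>

definition spread :: "('v \<Rightarrow> complex) \<Rightarrow> 'v \<times> nat \<Rightarrow> complex" where
  "spread f y = f (fst y) * of_real (sqrt (m (fst y) (snd y) / total_mass (fst y)))"

lemma spread_ell2:
  assumes f: "f \<in> ell2_set V" shows "spread f \<in> ell2_set (V \<times> UNIV)"
proof -
  have "nsum (\<lambda>y. ennreal ((cmod (spread f y))\<^sup>2)) =
      nsum (\<lambda>v. nsum (\<lambda>k. ennreal ((cmod (spread f (v, k)))\<^sup>2)))"
    using nsum_pair[of "\<lambda>v k. ennreal ((cmod (spread f (v, k)))\<^sup>2)"] by simp
  also have "\<dots> = nsum (\<lambda>v. ennreal ((cmod (f v))\<^sup>2))"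
  proof (rule nn_integral_cong)
    fix v
    show "nsum (\<lambda>k. ennreal ((cmod (spread f (v, k)))\<^sup>2)) = ennreal ((cmod (f v))\<^sup>2)"
    proof (cases "v \<in> V")
      case True
      have "ennreal ((cmod (spread f (v, k)))\<^sup>2) = ennreal ((cmod (f v))\<^sup>2) * ennreal (m v k * real (Suc k) ^ 0 / total_mass v)"
        for k
        using total_pos[OF True] m_pos[of v k]
        by (simp add: spread_def norm_mult power_mult_distrib ennreal_mult''[symmetric])
      then have "nsum (\<lambda>k. ennreal ((cmod (spread f (v, k)))\<^sup>2)) = ennreal ((cmod (f v))\<^sup>2) * moment 0 v"
        unfolding moment_def by (simp only: nn_integral_cmult borel_measurable_count_space)
      then show ?thesis using moment_0[OF True] by simp
    qed (use ell2_off[OF f] in \<open>simp add: spread_def\<close>)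
  qed
  finally show ?thesis
    using f by (auto simp: ell2_set_iff_nsum) (auto simp: spread_def)
qed

lemma scal_spread:
  assumes f: "f \<in> ell2_set V" and g: "g \<in> ell2_set V"
  shows "scal (spread f) (spread g) = scal f g"
proof -
  let ?s = "\<lambda>y. spread f y * cnj (spread g y)"
  have s: "?s summable_on (UNIV \<times> UNIV)"
    using ell2_product(1)[OF spread_ell2[OF f] spread_ell2[OF g]] by simp
  have "scal (spread f) (spread g) = (\<Sum>\<^sub>\<infinity>v. \<Sum>\<^sub>\<infinity>k. ?s (v, k))"
    using infsum_Sigma_banach[OF s] by (simp add: scal_def)
  also have "\<dots> = (\<Sum>\<^sub>\<infinity>v. f v * cnj (g v))"
  proof (rule infsum_cong)
    fix v
    show "(\<Sum>\<^sub>\<infinity>k. ?s (v, k)) = f v * cnj (g v)"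
    proof (cases "v \<in> V")
      case True
      have t: "total_mass v > 0" by (rule total_pos[OF True])
      have s: "(\<lambda>k. m v k / total_mass v) summable_on UNIV"
      proof (rule nsum_finite_iff_summable[THEN iffD1])
        show "nsum (\<lambda>k. ennreal (m v k / total_mass v)) < \<infinity>"
          using moment_0[OF True] by (simp add: moment_def)
      qed (use t m_pos[of v] in \<open>simp add: less_imp_le\<close>)
      have "(\<Sum>\<^sub>\<infinity>k. m v k / total_mass v) = 1"
      proof -
        have "ennreal (\<Sum>\<^sub>\<infinity>k. m v k / total_mass v) = nsum (\<lambda>k. ennreal (m v k / total_mass v))"
          using nsum_eq_infsum[OF _ s] t m_pos[of v] by (simp add: less_imp_le)
        also have "\<dots> = 1" using moment_0[OF True] by (simp add: moment_def)
        finally show ?thesis by simp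
      qed
      then have "((\<lambda>k. m v k / total_mass v) has_sum 1) UNIV" using s has_sum_infsum by metis
      then have "((\<lambda>k. complex_of_real (m v k / total_mass v)) has_sum of_real 1) UNIV"
        by (rule has_sum_of_real)
      then have "((\<lambda>k. (f v * cnj (g v)) * of_real (m v k / total_mass v)) has_sum (f v * cnj (g v)) * of_real 1) UNIV"
        by (rule has_sum_cmult_right)
      moreover have "?s (v, k) = (f v * cnj (g v)) * of_real (m v k / total_mass v)" for k
      proof -
        have "of_real (sqrt (m v k / total_mass v)) * of_real (sqrt (m v k / total_mass v)) = complex_of_real (m v k / total_mass v)"
          using t m_pos[of v k] by (simp flip: of_real_mult)
        then show ?thesis by (simp add: spread_def mult_ac)
      qed
      ultimately show ?thesis by (simp add: infsumI)
    qed (use ell2_off[OF f] in \<open>simp add: spread_def\<close>)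
  qed
  finally show ?thesis by (simp add: scal_def)
qed

text \<open>The square root of \<open>t\<close> cancels the denominator in \<open>fibre_weight\<close>, and the factor \<open>boost\<close> that
  remains is the ratio between the mass functions of \<open>v\<close> and of its parent.\<close>

lemma spread_intertwines:
  "dilation.T (\<lambda>y. of_real (sqrt (Suc (snd y))) * spread f y) = spread (L f)"
proof
  fix y :: "'v \<times> nat"
  obtain v k where y: "y = (v, k)" by fastforce
  show "dilation.T (\<lambda>y. of_real (sqrt (Suc (snd y))) * spread f y) y = spread (L f) y"
  proof (cases "v \<in> nonroots V E")
    case True
    let ?u = "parent E v"
    have t: "total_mass v > 0" "total_mass ?u > 0" using nonroot_total_pos[OF True] by auto
    have "sqrt (share v * boost v k / Suc k) * (sqrt (Suc k) * sqrt (m ?u k / total_mass ?u)) =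
        sqrt ((share v * boost v k / Suc k) * (Suc k * (m ?u k / total_mass ?u)))"
      by (simp only: real_sqrt_mult)
    also have "(share v * boost v k / Suc k) * (Suc k * (m ?u k / total_mass ?u)) =
        (share v * total_mass v / total_mass ?u) * (m v k / total_mass v)"
      using t by (simp add: m_step[OF True] del: of_nat_Suc)
    also have "sqrt ((share v * total_mass v / total_mass ?u) * (m v k / total_mass v)) =
        sqrt (share v * total_mass v / total_mass ?u) * sqrt (m v k / total_mass v)"
      by (simp only: real_sqrt_mult)
    finally have "complex_of_real (sqrt (share v * boost v k / Suc k) * (sqrt (Suc k) * sqrt (m ?u k / total_mass ?u))) =
        of_real (sqrt (share v * total_mass v / total_mass ?u) * sqrt (m v k / total_mass v))"
      by (rule arg_cong)
    then show ?thesis using True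
      by (simp add: y map_shift_def shift_map_def spread_def fibre_weight_def weight_def mult_ac
          del: of_nat_Suc)
  qed (simp add: y map_shift_def shift_map_def spread_def)
qed

definition hilbert_embed :: "('v \<Rightarrow> complex) \<Rightarrow> ('v \<Rightarrow> complex) \<Rightarrow> complex" where
  "hilbert_embed f = dilation.glue (spread f) (\<lambda>_. 0)"

lemma hilbert_embed_ell2: "f \<in> ell2_set V \<Longrightarrow> hilbert_embed f \<in> ell2_set dilation.X"
  unfolding hilbert_embed_def by (intro dilation.glue_ell2 spread_ell2 ell2_zero)

lemma isometric_hilbert_embed: "isometric_embedding (ell2 V) (ell2 dilation.X) hilbert_embed"
proof -
  have "hilbert_embed (\<lambda>v. f v + g v) = (\<lambda>x. hilbert_embed f x + hilbert_embed g x)"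
    "hilbert_embed (\<lambda>v. c * f v) = (\<lambda>x. c * hilbert_embed f x)" for f g c
    unfolding hilbert_embed_def
    by (rule dilation.eq_glueI[symmetric]; auto simp: dilation.glue_off spread_def algebra_simps)+
  moreover have "scal (hilbert_embed f) (hilbert_embed g) = scal f g" if "f \<in> ell2_set V" "g \<in> ell2_set V" for f g
    using dilation.scal_split[OF hilbert_embed_ell2[OF that(1)] hilbert_embed_ell2[OF that(2)]] scal_spread[OF that]
    by (simp add: hilbert_embed_def) (simp add: scal_def)
  ultimately show ?thesis
    unfolding isometric_embedding_def
    by (simp add: hilbert_embed_ell2 ell2_ip_eq) (simp add: ell2_def)
qed

lemma subnormal_S:
  assumes "n > 0" shows "subnormal_operator (ell2 V) S"
proof -
  have "dilation.N (hilbert_embed f) = Some (hilbert_embed (L f))" if f: "f \<in> dom S" for f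
    unfolding hilbert_embed_def spread_intertwines[symmetric]
  proof (rule dilation.N_extends)
    show "spread f \<in> ell2_set (V \<times> UNIV)" using f by (simp add: dom_S spread_ell2)
    show "dilation.T (\<lambda>y. of_real (sqrt (Suc (snd y))) * spread f y) \<in> ell2_set (V \<times> UNIV)"
      unfolding spread_intertwines using f by (simp add: dom_S spread_ell2)
  qed
  moreover have "dilation.X \<noteq> {}" using nonempty by (auto simp: dilation.X_def)
  ultimately show ?thesis
    unfolding subnormal_operator_def
    using complex_hilbert_space_ell2[of V] complex_hilbert_space_ell2[of dilation.X] linear_operator_S densely_defined_S[OF assms]
      isometric_hilbert_embed dilation.normal_operator_N
    by (intro conjI exI[of _ "ell2 dilation.X"] exI[of _ hilbert_embed] exI[of _ dilation.N])
      (auto simp: the_S)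
qed

end

theorem theorem3p1:
  fixes V :: "'v set" and E :: "('v \<times> 'v) set" and n :: nat
  assumes "directed_tree V E"
    and "extremal V E"
    and "n > 0"
  shows "\<exists>l :: 'v \<Rightarrow> complex.
    (\<forall>v\<in>nonroots V E. l v \<noteq> 0) \<and>
    subnormal_operator (ell2 V) (weighted_shift V E l) \<and>
    densely_defined (ell2 V) (op_power (ell2 V) (weighted_shift V E l) n) \<and>
    dom (op_power (ell2 V) (weighted_shift V E l) (n + 1)) = {\<zero>\<^bsub>ell2 V\<^esub>}"
proof -
  interpret extremal_tree V E
    using assms by (simp add: extremal_tree_def extremal_tree_axioms_def)
  have "\<exists>m. shift_masses V E n m"
    using ex_masses[of n] extremal_tree_axioms
    unfolding shift_masses_def shift_masses_axioms_def by blast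
  then obtain m where "shift_masses V E n m" by blast
  then interpret shift_masses V E n m .
  show ?thesis
    using weight_nonzero subnormal_S[OF assms(3)] densely_defined_S_power[of n] dom_S_power_Suc_n
    by (intro exI[of _ weight]) simp
qed

end
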